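(* Let $\alpha\in\mathbb R$, $S_0>0$, and let $H\in C_y^2C_s^1(\mathbb R^{3+1})$, $H:\mathbb R^3\times\mathbb R\to\mathbb R^3$, be a time periodic solution with period $S_0$ (i.e. $H(y,s+S_0)=H(y,s)$ for all $(y,s)$) of $$\partial_s H+\frac{\alpha}{\alpha+2}H+\frac{1}{\alpha+2}(y\cdot\nabla)H+\nabla\times((\nabla\times H)\times H)=0,\qquad \nabla\cdot H=0\qquad\text{on }\mathbb R^3\times\mathbb R.$$ Let $J=\nabla\times H$ and suppose $$\lim_{|y|\to\infty}\ \sup_{0<s<S_0}\left(|J(y,s)|+|\nabla J(y,s)|\right)=0.$$ In addition, assume either (i) $\alpha>0$ and there exists $q$ with $0<q<\frac3\alpha$ such that $H\in L^q(\mathbb R^3\times[0,S_0])$, or (ii) $-2<\alpha\le0$ and there exists $q>0$ such that $H\in L^q(\mathbb R^3\times[0,S_0])$. Then $H\equiv0$ on $\mathbb R^{3+1}$.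
   Context: All spatial differential operators ($\nabla$, $\nabla\times$, $\nabla\cdot$) act in the variable $y\in\mathbb R^3$. $\mathbb R^{3+1}=\mathbb R^3\times\mathbb R$ with points $(y,s)$. $C_y^2C_s^1(\mathbb R^{3+1})$ denotes (vector-valued) functions that are $C^2$ in $y$ and $C^1$ in $s$. For $q>0$ (including $q<1$), $H\in L^q(\mathbb R^3\times[0,S_0])$ means $\int_0^{S_0}\int_{\mathbb R^3}|H(y,s)|^q\,dy\,ds<\infty$. *)

theory Defs
  imports "HOL-Analysis.Analysis"
begin

(* The entry (i, j) of "jacobian F (at y)" is the partial derivative of the i-th component of F
   in the j-th coordinate direction. *)

definition curl :: "(real^3 \<Rightarrow> real^3) \<Rightarrow> real^3 \<Rightarrow> real^3" where
  "curl F y = (let D = jacobian F (at y) in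
     vector [D $ 3 $ 2 - D $ 2 $ 3,
             D $ 1 $ 3 - D $ 3 $ 1,
             D $ 2 $ 1 - D $ 1 $ 2])"

definition divergence :: "(real^3 \<Rightarrow> real^3) \<Rightarrow> real^3 \<Rightarrow> real" where
  "divergence F y = trace (jacobian F (at y))"

(* (v . grad) F *)
definition advect :: "real^3 \<Rightarrow> (real^3 \<Rightarrow> real^3) \<Rightarrow> real^3 \<Rightarrow> real^3" where
  "advect v F y = jacobian F (at y) *v v"

(* The class C_y^2 C_s^1: the derivatives D, D2 of first and second order in y and the derivative
   Ds of first order in s exist everywhere and, like H itself, are continuous in (y, s) jointly. *)
definition C2y_C1s :: "(real^3 \<Rightarrow> real \<Rightarrow> real^3) \<Rightarrow> bool" where
  "C2y_C1s H \<longleftrightarrow>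
     continuous_on UNIV (\<lambda>(y, s). H y s) \<and>
     (\<exists>(D :: real^3 \<Rightarrow> real \<Rightarrow> ((real^3) \<Rightarrow>\<^sub>L (real^3)))
       (D2 :: real^3 \<Rightarrow> real \<Rightarrow> ((real^3) \<Rightarrow>\<^sub>L ((real^3) \<Rightarrow>\<^sub>L (real^3))))
       (Ds :: real^3 \<Rightarrow> real \<Rightarrow> real^3).
        (\<forall>y s. ((\<lambda>z. H z s) has_derivative blinfun_apply (D y s)) (at y)) \<and>
        (\<forall>y s. ((\<lambda>z. D z s) has_derivative blinfun_apply (D2 y s)) (at y)) \<and>
        (\<forall>y s. ((\<lambda>t. H y t) has_vector_derivative Ds y s) (at s)) \<and>
        continuous_on UNIV (\<lambda>(y, s). D y s) \<and>
        continuous_on UNIV (\<lambda>(y, s). D2 y s) \<and>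
        continuous_on UNIV (\<lambda>(y, s). Ds y s))"

(* H in L^q(R^3 x [0, S]), for any q > 0, including q < 1 *)
definition in_Lq :: "real \<Rightarrow> real \<Rightarrow> (real^3 \<Rightarrow> real \<Rightarrow> real^3) \<Rightarrow> bool" where
  "in_Lq q S H \<longleftrightarrow>
     (\<integral>\<^sup>+ s \<in> {0..S}. (\<integral>\<^sup>+ y. ennreal (norm (H y s) powr q) \<partial>lborel) \<partial>lborel) < \<infinity>"

end

theory Submission
  imports Defs
begin

text \<open>
  Put \<open>\<beta> = 1 / (\<alpha> + 2)\<close>, which is positive in both cases, and \<open>b = \<beta> y - J\<close>. Since \<open>H\<close> and
  \<open>J\<close> are divergence free, the vector identity for \<open>curl (J \<times> H)\<close> turns the equation into
  \<open>\<partial>\<^sub>s H + (b . grad) H = - \<alpha> \<beta> H - (H . grad) J\<close>: the field is frozen into the flow of \<open>b\<close>. Two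
  features of this flow force \<open>H\<close> to vanish. It expands volume at the constant rate
  \<open>div b = 3 \<beta>\<close>, while along it \<open>\<bar>H\<bar>\<^sup>q\<close> decays at a rate of at most
  \<open>q (max 0 (\<alpha> \<beta>) + \<bar>grad J\<bar>)\<close>. Hence wherever
  \<open>q (max 0 (\<alpha> \<beta>) + \<bar>grad J\<bar>) < 3 \<beta>\<close> the integral of \<open>\<bar>H\<bar>\<^sup>q\<close> can only grow in time,
  which a nonzero periodic quantity cannot do.

  This is used twice. Far from the origin \<open>grad J\<close> is small, the inequality holds for the given
  exponent (for positive \<open>\<alpha>\<close> this is what \<open>q < 3 / \<alpha>\<close> means), and \<open>b\<close> points outward, so that the
  flow carries mass into the exterior of a ball but never out of it, and integrability of \<open>\<bar>H\<bar>\<^sup>q\<close>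
  prevents an escape to infinity. So \<open>H\<close> vanishes outside a ball. After that \<open>\<bar>H\<bar>\<^sup>q\<close> is
  integrable for every positive exponent, \<open>grad J\<close> is bounded, and a sufficiently small exponent
  satisfies the inequality on the whole space; as the exponent tends to 0, the argument becomes the
  remark that a flow which expands volume cannot carry a set of finite positive measure to itself.

  The balance behind this is \<open>transport_inequality\<close>, obtained by integrating the space-time divergence
  of \<open>\<psi> \<rho>\<^sup>p (b, 1)\<close> over one period, with \<open>\<rho> = \<bar>H\<bar>\<^sup>2\<close>, \<open>p = q / 2\<close> and a spatial cutoff \<open>\<psi>\<close>;
  \<open>vanishes_where_cutoff_positive\<close> removes the cutoff at infinity and draws the conclusion, and
  \<open>curl_cross3_curl\<close> brings the equation into transport form.
\<close>

section \<open>Symmetry of second derivatives\<close>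

text \<open>
  The mean value theorem, once in the direction \<open>u\<close> and once in the direction \<open>v\<close>. The left-hand
  side does not change when \<open>u\<close> and \<open>v\<close> are exchanged, the right-hand side exchanges the order of
  differentiation.
\<close>

lemma second_difference_mean_value:
  fixes f :: "'a::real_normed_vector \<Rightarrow> real"
  assumes f: "\<And>x. (f has_derivative f' x) (at x)"
    and f': "\<And>x u. ((\<lambda>z. f' z u) has_derivative (\<lambda>v. f'' x v u)) (at x)"
    and "t > 0"
  shows "\<exists>\<xi> \<eta>. 0 \<le> \<xi> \<and> \<xi> \<le> t \<and> 0 \<le> \<eta> \<and> \<eta> \<le> t \<and>
    f (x + t *\<^sub>R u + t *\<^sub>R v) - f (x + t *\<^sub>R u) - f (x + t *\<^sub>R v) + f x
      = t * t * f'' (x + \<xi> *\<^sub>R u + \<eta> *\<^sub>R v) v u"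
proof -
  have lin: "linear (f' z)" "linear (\<lambda>w. f'' z w u')" for z u'
    using f f' has_derivative_linear by blast+
  have "\<exists>\<xi>. 0 < \<xi> \<and> \<xi> < t \<and>
      (f (x + t *\<^sub>R u + t *\<^sub>R v) - f (x + t *\<^sub>R u)) - (f (x + 0 *\<^sub>R u + t *\<^sub>R v) - f (x + 0 *\<^sub>R u))
      = (t - 0) * (f' (x + \<xi> *\<^sub>R u + t *\<^sub>R v) u - f' (x + \<xi> *\<^sub>R u) u)"
  proof (rule MVT2[OF \<open>t > 0\<close>])
    fix \<xi>
    have "((\<lambda>\<xi>. f (x + \<xi> *\<^sub>R u + t *\<^sub>R v) - f (x + \<xi> *\<^sub>R u)) has_derivative
       (\<lambda>h. f' (x + \<xi> *\<^sub>R u + t *\<^sub>R v) (h *\<^sub>R u) - f' (x + \<xi> *\<^sub>R u) (h *\<^sub>R u))) (at \<xi>)"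
      by (auto intro!: derivative_eq_intros has_derivative_compose[OF _ f])
    then show "((\<lambda>\<xi>. f (x + \<xi> *\<^sub>R u + t *\<^sub>R v) - f (x + \<xi> *\<^sub>R u)) has_real_derivative
       (f' (x + \<xi> *\<^sub>R u + t *\<^sub>R v) u - f' (x + \<xi> *\<^sub>R u) u)) (at \<xi>)"
      unfolding has_field_derivative_def
      by (rule has_derivative_eq_rhs) (simp add: linear_scale[OF lin(1)] fun_eq_iff algebra_simps)
  qed
  then obtain \<xi> where \<xi>: "0 < \<xi>" "\<xi> < t"
      "f (x + t *\<^sub>R u + t *\<^sub>R v) - f (x + t *\<^sub>R u) - (f (x + t *\<^sub>R v) - f x)
      = t * (f' (x + \<xi> *\<^sub>R u + t *\<^sub>R v) u - f' (x + \<xi> *\<^sub>R u) u)" by auto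
  have "\<exists>\<eta>. 0 < \<eta> \<and> \<eta> < t \<and>
      f' (x + \<xi> *\<^sub>R u + t *\<^sub>R v) u - f' (x + \<xi> *\<^sub>R u + 0 *\<^sub>R v) u = (t - 0) * f'' (x + \<xi> *\<^sub>R u + \<eta> *\<^sub>R v) v u"
  proof (rule MVT2[OF \<open>t > 0\<close>])
    fix \<eta>
    have "((\<lambda>\<eta>. f' (x + \<xi> *\<^sub>R u + \<eta> *\<^sub>R v) u) has_derivative
       (\<lambda>h. f'' (x + \<xi> *\<^sub>R u + \<eta> *\<^sub>R v) (h *\<^sub>R v) u)) (at \<eta>)"
      by (auto intro!: derivative_eq_intros has_derivative_compose[OF _ f'])
    then show "((\<lambda>\<eta>. f' (x + \<xi> *\<^sub>R u + \<eta> *\<^sub>R v) u) has_real_derivative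
       f'' (x + \<xi> *\<^sub>R u + \<eta> *\<^sub>R v) v u) (at \<eta>)"
      unfolding has_field_derivative_def
      by (rule has_derivative_eq_rhs) (simp add: linear_scale[OF lin(2)] fun_eq_iff algebra_simps)
  qed
  then obtain \<eta> where "0 < \<eta>" "\<eta> < t"
      "f' (x + \<xi> *\<^sub>R u + t *\<^sub>R v) u - f' (x + \<xi> *\<^sub>R u) u = t * f'' (x + \<xi> *\<^sub>R u + \<eta> *\<^sub>R v) v u" by auto
  with \<xi> show ?thesis
    by (intro exI[of _ \<xi>] exI[of _ \<eta>]) (simp add: algebra_simps)
qed

lemma symmetric_second_derivative:
  fixes f :: "'a::real_normed_vector \<Rightarrow> real"
  assumes f: "\<And>x. (f has_derivative f' x) (at x)"
    and f': "\<And>x u. ((\<lambda>z. f' z u) has_derivative (\<lambda>v. f'' x v u)) (at x)"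
    and cont: "\<And>u v. continuous_on UNIV (\<lambda>x. f'' x v u)"
  shows "f'' x u v = f'' x v u"
proof -
  define t where "t n = inverse (real (Suc n))" for n
  have t: "t n > 0" for n by (simp add: t_def)
  have t0: "t \<longlonglongrightarrow> 0" unfolding t_def by (rule LIMSEQ_inverse_real_of_nat)
  have lim: "(\<lambda>n. (f (x + t n *\<^sub>R u + t n *\<^sub>R v) - f (x + t n *\<^sub>R u) - f (x + t n *\<^sub>R v) + f x) / (t n * t n))
      \<longlonglongrightarrow> f'' x v u" for u v
  proof -
    have "\<forall>n. \<exists>\<xi> \<eta>. 0 \<le> \<xi> \<and> \<xi> \<le> t n \<and> 0 \<le> \<eta> \<and> \<eta> \<le> t n \<and>
      f (x + t n *\<^sub>R u + t n *\<^sub>R v) - f (x + t n *\<^sub>R u) - f (x + t n *\<^sub>R v) + f x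
      = t n * t n * f'' (x + \<xi> *\<^sub>R u + \<eta> *\<^sub>R v) v u"
      using second_difference_mean_value[OF f f' t, where ?x = x] by blast
    then obtain \<xi> \<eta> where 1: "\<And>n. 0 \<le> \<xi> n" "\<And>n. \<xi> n \<le> t n" "\<And>n. 0 \<le> \<eta> n" "\<And>n. \<eta> n \<le> t n"
      and 2: "\<And>n. f (x + t n *\<^sub>R u + t n *\<^sub>R v) - f (x + t n *\<^sub>R u) - f (x + t n *\<^sub>R v) + f x
      = t n * t n * f'' (x + \<xi> n *\<^sub>R u + \<eta> n *\<^sub>R v) v u"
      by metis
    have "\<xi> \<longlonglongrightarrow> 0" "\<eta> \<longlonglongrightarrow> 0"
      by (rule tendsto_sandwich[OF _ _ tendsto_const t0]; simp add: 1)+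
    then have "(\<lambda>n. x + \<xi> n *\<^sub>R u + \<eta> n *\<^sub>R v) \<longlonglongrightarrow> x + 0 *\<^sub>R u + 0 *\<^sub>R v"
      by (intro tendsto_intros)
    then have "(\<lambda>n. f'' (x + \<xi> n *\<^sub>R u + \<eta> n *\<^sub>R v) v u) \<longlonglongrightarrow> f'' x v u"
      using continuous_on_tendsto_compose[OF cont[where u=u and v=v]] by force
    moreover have "(f (x + t n *\<^sub>R u + t n *\<^sub>R v) - f (x + t n *\<^sub>R u) - f (x + t n *\<^sub>R v) + f x) / (t n * t n)
       = f'' (x + \<xi> n *\<^sub>R u + \<eta> n *\<^sub>R v) v u" for n
      using t[of n] by (subst 2) simp
    ultimately show ?thesis by simp
  qed
  have eq: "f (x + t n *\<^sub>R v + t n *\<^sub>R u) - f (x + t n *\<^sub>R v) - f (x + t n *\<^sub>R u) + f x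
     = f (x + t n *\<^sub>R u + t n *\<^sub>R v) - f (x + t n *\<^sub>R u) - f (x + t n *\<^sub>R v) + f x" for n
    by (simp add: algebra_simps)
  from lim[of v u] have "(\<lambda>n. (f (x + t n *\<^sub>R u + t n *\<^sub>R v) - f (x + t n *\<^sub>R u) - f (x + t n *\<^sub>R v) + f x) / (t n * t n))
      \<longlonglongrightarrow> f'' x u v" unfolding eq .
  then show ?thesis using lim[of u v] LIMSEQ_unique by blast
qed

section \<open>Integrals of divergences with compact support\<close>

text \<open>
  The integral of \<open>f (x + h e)\<close> over the box does not depend on \<open>h\<close>, since translation keeps the
  support of \<open>f\<close> in the box as long as \<open>h\<close> stays in \<open>[-1, 1]\<close>. Differentiation under the integral
  at \<open>h = 0\<close> gives the claim.
\<close>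

lemma integral_directional_derivative_eq_0:
  fixes f :: "'a::euclidean_space \<Rightarrow> real"
  assumes f: "\<And>x. (f has_derivative f' x) (at x)"
    and cont: "continuous_on UNIV (\<lambda>x. f' x e)"
    and supp: "\<And>x. norm x > L \<Longrightarrow> f x = 0"
    and e: "norm e = 1"
    and box: "cball 0 (L + 1) \<subseteq> cbox a b"
  shows "integral (cbox a b) (\<lambda>x. f' x e) = 0"
proof -
  define U :: "real set" where "U = {-1..1}"
  have lin: "linear (f' z)" for z using f has_derivative_linear by blast
  have cf: "continuous_on S f" for S
    by (intro continuous_at_imp_continuous_on ballI has_derivative_continuous[OF f])
  have "((\<lambda>h. integral (cbox a b) (\<lambda>x. f (x + h *\<^sub>R e))) has_vector_derivative
      integral (cbox a b) (\<lambda>x. f' (x + 0 *\<^sub>R e) e)) (at 0 within U)"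
  proof (rule leibniz_rule_vector_derivative)
    fix h x
    have "((\<lambda>h. f (x + h *\<^sub>R e)) has_derivative (\<lambda>k. f' (x + h *\<^sub>R e) (k *\<^sub>R e))) (at h within U)"
      by (auto intro!: derivative_eq_intros has_derivative_compose[OF _ f])
    then show "((\<lambda>h. f (x + h *\<^sub>R e)) has_vector_derivative f' (x + h *\<^sub>R e) e) (at h within U)"
      unfolding has_vector_derivative_def
      by (rule has_derivative_eq_rhs) (simp add: linear_scale[OF lin] fun_eq_iff)
    show "(\<lambda>x. f (x + h *\<^sub>R e)) integrable_on cbox a b"
      by (intro integrable_continuous continuous_on_compose2[OF cf[of UNIV]] continuous_intros) auto
    show "continuous_on (U \<times> cbox a b) (\<lambda>(h, x). f' (x + h *\<^sub>R e) e)"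
      unfolding split_beta
      by (intro continuous_on_compose2[OF cont] continuous_intros) auto
  qed (auto simp: U_def)
  moreover have "integral (cbox a b) (\<lambda>x. f (x + h *\<^sub>R e)) = integral UNIV f" if "h \<in> U" for h
  proof -
    have "integral (cbox a b) (\<lambda>x. f (x + h *\<^sub>R e)) = integral (cbox (a + h *\<^sub>R e) (b + h *\<^sub>R e)) f"
      using integral_shift_cbox_plus[of a b f "h *\<^sub>R e"] by (simp add: o_def add_ac)
    also have "\<dots> = integral UNIV (\<lambda>x. if x \<in> cbox (a + h *\<^sub>R e) (b + h *\<^sub>R e) then f x else 0)"
      by (simp add: integral_restrict_UNIV)
    also have "(\<lambda>x. if x \<in> cbox (a + h *\<^sub>R e) (b + h *\<^sub>R e) then f x else 0) = f"
    proof
      fix x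
      have "x \<in> cbox (a + h *\<^sub>R e) (b + h *\<^sub>R e)" if "f x \<noteq> 0"
      proof -
        have "norm x \<le> L" using supp that by force
        moreover have "norm (h *\<^sub>R e) \<le> 1" using \<open>h \<in> U\<close> e by (auto simp: U_def)
        ultimately have "norm (x - h *\<^sub>R e) \<le> L + 1"
          using norm_triangle_ineq4[of x "h *\<^sub>R e"] by linarith
        then have "x - h *\<^sub>R e \<in> cbox a b" using box by auto
        then show ?thesis by (auto simp: mem_box algebra_simps)
      qed
      then show "(if x \<in> cbox (a + h *\<^sub>R e) (b + h *\<^sub>R e) then f x else 0) = f x" by auto
    qed
    finally show ?thesis .
  qed
  ultimately have "((\<lambda>h. integral UNIV f) has_vector_derivative integral (cbox a b) (\<lambda>x. f' (x + 0 *\<^sub>R e) e)) (at 0 within U)"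
    by (elim has_vector_derivative_transform_within[where d = 1]) (auto simp: U_def)
  then have "integral (cbox a b) (\<lambda>x. f' (x + 0 *\<^sub>R e) e) = 0"
    unfolding U_def
    by (intro vector_derivative_unique_within_closed_interval[of "-1" 1 0 "\<lambda>h. integral UNIV f"]) auto
  then show ?thesis by simp
qed

lemma integral_divergence_eq_0:
  fixes F :: "'a::euclidean_space \<Rightarrow> 'a"
  assumes F: "\<And>x. (F has_derivative F' x) (at x)"
    and cont: "\<And>e. continuous_on UNIV (\<lambda>x. F' x e)"
    and supp: "\<And>x. norm x > L \<Longrightarrow> F x = 0"
    and box: "cball 0 (L + 1) \<subseteq> cbox a b"
  shows "integral (cbox a b) (\<lambda>x. \<Sum>i\<in>Basis. F' x i \<bullet> i) = 0"
proof -
  have "integral (cbox a b) (\<lambda>x. F' x i \<bullet> i) = 0" if "i \<in> Basis" for i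
    by (rule integral_directional_derivative_eq_0[where f = "\<lambda>x. F x \<bullet> i" and f' = "\<lambda>x v. F' x v \<bullet> i"])
      (use that supp box in \<open>auto intro!: has_derivative_inner_left F continuous_on_inner cont\<close>)
  moreover have "(\<lambda>x. F' x i \<bullet> i) integrable_on cbox a b" for i
    by (intro integrable_continuous continuous_intros continuous_on_subset[OF cont]) auto
  ultimately show ?thesis by (subst integral_sum) auto
qed

section \<open>Densities carried by an expanding flow\<close>

lemma continuous_on_joint:
  assumes "continuous_on UNIV (\<lambda>(y, s). f y s)" "continuous_on A g" "continuous_on A h"
  shows "continuous_on A (\<lambda>x. f (g x) (h x))"
  using continuous_on_compose2[OF assms(1) continuous_on_Pair[OF assms(2,3)]] by simp

text \<open>
  A nonnegative density \<open>\<rho>\<close>, periodic in time, with spatial gradient \<open>G\<close> and time derivative \<open>T\<close>, and a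
  velocity field \<open>b\<close> of constant divergence \<open>d\<close>. The derivative of \<open>\<rho>\<close> along the flow is
  \<open>T + G \<bullet> b\<close>; bounds on it hold only in parts of space and are therefore left to the lemmas.
\<close>

locale transport =
  fixes \<rho> T :: "'a::euclidean_space \<Rightarrow> real \<Rightarrow> real"
    and G b :: "'a \<Rightarrow> real \<Rightarrow> 'a" and b' :: "'a \<Rightarrow> real \<Rightarrow> 'a \<Rightarrow> 'a"
    and d S :: real
  assumes \<rho>_space: "\<And>y s. ((\<lambda>z. \<rho> z s) has_derivative (\<lambda>v. G y s \<bullet> v)) (at y)"
    and \<rho>_time: "\<And>y s. ((\<lambda>t. \<rho> y t) has_real_derivative T y s) (at s)"
    and cont_\<rho>: "continuous_on UNIV (\<lambda>(y, s). \<rho> y s)"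
    and cont_G: "continuous_on UNIV (\<lambda>(y, s). G y s)"
    and cont_T: "continuous_on UNIV (\<lambda>(y, s). T y s)"
    and \<rho>_nonneg: "\<And>y s. 0 \<le> \<rho> y s"
    and period: "\<And>y. \<rho> y S = \<rho> y 0"
    and S: "0 < S"
    and b_space: "\<And>y s. ((\<lambda>z. b z s) has_derivative b' y s) (at y)"
    and cont_b: "continuous_on UNIV (\<lambda>(y, s). b y s)"
    and cont_b': "\<And>e. continuous_on UNIV (\<lambda>(y, s). b' y s e)"
    and div_b: "\<And>y s. (\<Sum>i\<in>Basis. b' y s i \<bullet> i) = d"
begin

text \<open>
  Along the flow \<open>\<rho>\<^sup>p\<close> decays at a rate of at most \<open>2 p k\<close>, volume grows at the rate \<open>d\<close>, and periodicity
  makes the total change over one period zero, so the surplus \<open>d - 2 p k\<close> has to be paid for by the flux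
  through the region where the cutoff \<open>\<psi>\<close> varies. Since \<open>\<rho>\<^sup>p\<close> need not be differentiable where \<open>\<rho>\<close>
  vanishes, the balance is derived for \<open>(\<rho> + \<delta>)\<^sup>p\<close>. The compact support of \<open>\<psi>\<close> keeps all integrals
  finite for positive \<open>\<delta>\<close> and lets \<open>\<delta>\<close> tend to 0 at the end.
\<close>

lemma transport_inequality:
  fixes \<psi> :: "'a \<Rightarrow> real" and P :: "'a \<Rightarrow> 'a"
  assumes \<psi>_space: "\<And>y. (\<psi> has_derivative (\<lambda>v. P y \<bullet> v)) (at y)"
    and cont_P: "continuous_on UNIV P"
    and \<psi>_nonneg: "\<And>y. 0 \<le> \<psi> y"
    and supp: "\<And>y. norm y > L \<Longrightarrow> \<psi> y = 0"
    and box: "cball 0 (L + 1) \<subseteq> cbox l u"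
    and decay: "\<And>y s. \<lbrakk>0 \<le> s; s \<le> S; \<psi> y \<noteq> 0\<rbrakk> \<Longrightarrow> T y s + G y s \<bullet> b y s \<ge> - (2 * k * \<rho> y s)"
    and k: "0 \<le> k" and p: "0 < p"
  shows "(d - 2 * p * k) * integral (cbox (l, 0) (u, S)) (\<lambda>(y, s). \<psi> y * \<rho> y s powr p)
      \<le> - integral (cbox (l, 0) (u, S)) (\<lambda>(y, s). \<rho> y s powr p * (P y \<bullet> b y s))"
proof -
  define Q where "Q = cbox (l, 0) (u, S)"
  have cont_\<psi>: "continuous_on A \<psi>" for A
    by (intro continuous_at_imp_continuous_on ballI has_derivative_continuous[OF \<psi>_space])
  have cont_P': "continuous_on A P" for A
    using continuous_on_subset[OF cont_P subset_UNIV] .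
  note cont [continuous_intros] = continuous_on_joint[OF cont_\<rho>] continuous_on_joint[OF cont_G]
    continuous_on_joint[OF cont_T] continuous_on_joint[OF cont_b] continuous_on_joint[OF cont_b']
    continuous_on_compose2[OF cont_\<psi>[of UNIV] _ subset_UNIV]
    continuous_on_compose2[OF cont_P'[of UNIV] _ subset_UNIV]
  \<comment> \<open>The integrand of the claim, both sides collected and \<open>\<rho>\<close> replaced by \<open>\<rho> + \<delta>\<close>.\<close>
  define \<Psi> where "\<Psi> \<delta> x = (d - 2 * p * k) * (\<psi> (fst x) * (\<rho> (fst x) (snd x) + \<delta>) powr p)
      + (\<rho> (fst x) (snd x) + \<delta>) powr p * (P (fst x) \<bullet> b (fst x) (snd x))" for \<delta> x
  have cont_\<rho>_powr: "continuous_on A (\<lambda>x. (\<rho> (f x) (h x) + e x) powr p)"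
    if "continuous_on A f" "continuous_on A h" "continuous_on A e" "\<And>x. x \<in> A \<Longrightarrow> 0 \<le> e x"
    for A :: "'z::topological_space set" and f h e
    using that \<rho>_nonneg p
    by (intro continuous_on_powr' continuous_on_add continuous_on_joint[OF cont_\<rho>] continuous_on_const)
      (auto intro: add_nonneg_nonneg)
  have cont_\<rho>_powr0: "continuous_on A (\<lambda>x. \<rho> (f x) (h x) powr p)"
    if "continuous_on A f" "continuous_on A h" for A :: "'z::topological_space set" and f h
    using cont_\<rho>_powr[OF that continuous_on_const, of 0] by simp
  have cont_\<Psi>: "continuous_on ({0..1} \<times> A) (\<lambda>(\<delta>, x). \<Psi> \<delta> x)" for A
    unfolding \<Psi>_def split_beta
    by (intro continuous_on_add continuous_on_mult continuous_on_inner cont_\<rho>_powr cont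
        continuous_on_const continuous_on_fst continuous_on_snd continuous_on_id) auto
  have neg: "integral Q (\<Psi> \<delta>) \<le> 0" if \<delta>: "0 < \<delta>" for \<delta>
  proof -
    define g where "g y s = (\<rho> y s + \<delta>) powr p" for y s
    define m where "m y s = p * (\<rho> y s + \<delta>) powr (p - 1)" for y s
    have pos: "0 < \<rho> y s + \<delta>" for y s using \<rho>_nonneg[of y s] \<delta> by simp
    have cont_g [continuous_intros]: "continuous_on A f \<Longrightarrow> continuous_on A h \<Longrightarrow> continuous_on A (\<lambda>x. g (f x) (h x))"
      for A :: "'z::topological_space set" and f h
      unfolding g_def by (intro continuous_intros) (use pos in \<open>auto simp: less_imp_neq[symmetric]\<close>)
    have cont_m [continuous_intros]: "continuous_on A f \<Longrightarrow> continuous_on A h \<Longrightarrow> continuous_on A (\<lambda>x. m (f x) (h x))"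
      for A :: "'z::topological_space set" and f h
      unfolding m_def by (intro continuous_intros) (use pos in \<open>auto simp: less_imp_neq[symmetric]\<close>)
    have g_time: "((\<lambda>t. g y t) has_real_derivative m y s * T y s) (at s)" for y s
      unfolding g_def m_def
      by (rule DERIV_chain2[where f = "\<lambda>z. z powr p" and g = "\<lambda>t. \<rho> y t + \<delta>"])
        (auto intro!: derivative_eq_intros \<rho>_time has_real_derivative_powr pos)
    have g_space: "((\<lambda>z. g z s) has_derivative (\<lambda>v. m y s * (G y s \<bullet> v))) (at y)" for y s
      unfolding g_def m_def
      by (rule has_derivative_compose[where g = "\<lambda>z. z powr p" and f = "\<lambda>z. \<rho> z s + \<delta>"])
        (auto intro!: derivative_eq_intros \<rho>_space has_real_derivative_powr[unfolded has_field_derivative_def] pos)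
    \<comment> \<open>\<open>A\<close> is the time derivative of \<open>\<psi> g\<close> and integrates to 0 by periodicity, \<open>B\<close> is the divergence of
      \<open>\<psi> g b\<close> and integrates to 0 by compact support. Their sum dominates \<open>\<Psi> \<delta>\<close> pointwise.\<close>
    define A where "A y s = \<psi> y * (m y s * T y s)" for y s
    define B where "B y s = \<psi> y * g y s * d + \<psi> y * m y s * (G y s \<bullet> b y s) + g y s * (P y \<bullet> b y s)" for y s
    have "integral {0..S} (A y) = 0" for y
    proof -
      have "((\<lambda>s. \<psi> y * (m y s * T y s)) has_integral \<psi> y * g y S - \<psi> y * g y 0) {0..S}"
      proof (rule fundamental_theorem_of_calculus)
        show "((\<lambda>s. \<psi> y * g y s) has_vector_derivative \<psi> y * (m y s * T y s)) (at s within {0..S})" for s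
          by (rule has_vector_derivative_at_within)
            (rule DERIV_cmult[OF g_time, THEN has_real_derivative_iff_has_vector_derivative[THEN iffD1]])
      qed (use S in simp)
      moreover have "A y = (\<lambda>s. \<psi> y * (m y s * T y s))" by (simp add: A_def fun_eq_iff)
      ultimately show ?thesis by (metis integral_unique g_def period diff_self)
    qed
    moreover have cont_A: "continuous_on Q (\<lambda>(y, s). A y s)"
      unfolding A_def split_beta by (intro continuous_intros)
    ultimately have int_A: "integral Q (\<lambda>(y, s). A y s) = 0"
      unfolding Q_def by (subst integral_prod_continuous) (auto simp: Q_def)
    have "integral (cbox l u) (\<lambda>y. B y s) = 0" for s
    proof -
      define F where "F y = (\<psi> y * g y s) *\<^sub>R b y s" for y
      define F' where "F' y v = (\<psi> y * g y s) *\<^sub>R b' y s v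
          + (\<psi> y * (m y s * (G y s \<bullet> v)) + (P y \<bullet> v) * g y s) *\<^sub>R b y s" for y v
      have "integral (cbox l u) (\<lambda>y. \<Sum>i\<in>Basis. F' y i \<bullet> i) = 0"
      proof (rule integral_divergence_eq_0[OF _ _ _ box])
        show "(F has_derivative F' y) (at y)" for y
          unfolding F_def F'_def
          by (auto intro!: derivative_eq_intros \<psi>_space g_space b_space)
        show "continuous_on UNIV (\<lambda>y. F' y e)" for e
          unfolding F'_def by (intro continuous_intros)
        show "F y = 0" if "L < norm y" for y
          using supp[OF that] by (simp add: F_def)
      qed
      moreover have "(\<Sum>i\<in>Basis. F' y i \<bullet> i) = B y s" for y
      proof -
        have "(\<Sum>i\<in>Basis. F' y i \<bullet> i) = (\<Sum>i\<in>Basis. \<psi> y * g y s * (b' y s i \<bullet> i)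
           + \<psi> y * m y s * ((G y s \<bullet> i) * (b y s \<bullet> i)) + g y s * ((P y \<bullet> i) * (b y s \<bullet> i)))"
          by (intro sum.cong) (auto simp: F'_def algebra_simps)
        also have "\<dots> = B y s"
          unfolding B_def div_b[of y s, symmetric] euclidean_inner[of _ "b y s"]
          by (simp add: sum.distrib sum_distrib_left)
        finally show ?thesis .
      qed
      ultimately show ?thesis by simp
    qed
    moreover have cont_B: "continuous_on Q (\<lambda>(y, s). B y s)"
      unfolding B_def split_beta by (intro continuous_intros)
    moreover have "integral Q (\<lambda>(y, s). B y s) = integral (cbox 0 S) (\<lambda>s. integral (cbox l u) (\<lambda>y. B y s))"
      using integral_prod_continuous[OF cont_B[unfolded Q_def]] integral_swap_continuous[of l 0 u S "\<lambda>y s. B y s"]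
        cont_B by (simp add: Q_def)
    ultimately have int_B: "integral Q (\<lambda>(y, s). B y s) = 0"
      by simp
    have "integral Q (\<Psi> \<delta>) \<le> integral Q (\<lambda>x. (\<lambda>(y, s). A y s) x + (\<lambda>(y, s). B y s) x)"
    proof (rule integral_le)
      show "(\<lambda>x. (\<lambda>(y, s). A y s) x + (\<lambda>(y, s). B y s) x) integrable_on Q"
        using cont_A cont_B unfolding Q_def by (intro integrable_continuous continuous_on_add)
      show "\<Psi> \<delta> integrable_on Q"
        unfolding \<Psi>_def Q_def
        by (intro integrable_continuous continuous_on_add continuous_on_mult continuous_on_inner cont_\<rho>_powr cont
          continuous_on_const continuous_on_fst continuous_on_snd continuous_on_id) (use \<delta> in auto)
      fix x assume "x \<in> Q"
      then obtain y s where x: "x = (y, s)" "0 \<le> s" "s \<le> S" by (cases x) (auto simp: Q_def)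
      have g: "m y s * (\<rho> y s + \<delta>) = p * g y s"
        using pos[of y s] by (simp add: m_def g_def powr_diff)
      have m: "0 \<le> m y s" using p by (simp add: m_def)
      have "- (2 * p * k) * (\<psi> y * g y s) \<le> \<psi> y * m y s * (T y s + G y s \<bullet> b y s)"
      proof (cases "\<psi> y = 0")
        case False
        have "- (2 * p * k) * (\<psi> y * g y s) = \<psi> y * m y s * (- (2 * k * (\<rho> y s + \<delta>)))"
          using arg_cong[OF g[symmetric], of "\<lambda>z. - (2 * k * \<psi> y) * z"] by (simp add: mult_ac)
        also have "\<dots> \<le> \<psi> y * m y s * (- (2 * k * \<rho> y s))"
          using \<psi>_nonneg[of y] m k \<delta> by (intro mult_left_mono) (auto intro!: mult_left_mono)
        also have "\<dots> \<le> \<psi> y * m y s * (T y s + G y s \<bullet> b y s)"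
          using \<psi>_nonneg[of y] m decay[OF x(2,3) False] by (intro mult_left_mono) auto
        finally show ?thesis .
      qed auto
      moreover have "\<Psi> \<delta> x = (d - 2 * p * k) * (\<psi> y * g y s) + g y s * (P y \<bullet> b y s)"
        by (simp add: x \<Psi>_def g_def)
      ultimately show "\<Psi> \<delta> x \<le> (\<lambda>(y, s). A y s) x + (\<lambda>(y, s). B y s) x"
        by (simp add: x A_def B_def algebra_simps)
    qed
    also have "\<dots> = 0"
      using int_A int_B cont_A cont_B unfolding Q_def
      by (subst integral_add) (auto intro!: integrable_continuous)
    finally show ?thesis .
  qed
  have "continuous_on {0..1} (\<lambda>\<delta>. integral Q (\<Psi> \<delta>))"
    unfolding Q_def by (intro integral_continuous_on_param cont_\<Psi>)
  then have "((\<lambda>\<delta>. integral Q (\<Psi> \<delta>)) \<longlongrightarrow> integral Q (\<Psi> 0)) (at 0 within {0..1})"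
    by (auto simp: continuous_on_def)
  then have "((\<lambda>\<delta>. integral Q (\<Psi> \<delta>)) \<longlongrightarrow> integral Q (\<Psi> 0)) (at_right 0)"
    by (simp add: at_within_Icc_at_right)
  then have "integral Q (\<Psi> 0) \<le> 0"
    by (rule tendsto_upperbound) (auto intro!: neg eventually_at_rightI[of 0 1])
  moreover have "integral Q (\<Psi> 0) = (d - 2 * p * k) * integral Q (\<lambda>(y, s). \<psi> y * \<rho> y s powr p)
      + integral Q (\<lambda>(y, s). \<rho> y s powr p * (P y \<bullet> b y s))"
  proof -
    have 1: "(\<lambda>(y, s). \<psi> y * \<rho> y s powr p) integrable_on Q"
      unfolding Q_def split_beta
      by (intro integrable_continuous continuous_on_mult cont_\<rho>_powr0 continuous_intros)
    have 2: "(\<lambda>(y, s). \<rho> y s powr p * (P y \<bullet> b y s)) integrable_on Q"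
      unfolding Q_def split_beta
      by (intro integrable_continuous continuous_on_mult cont_\<rho>_powr0 continuous_intros)
    have "\<Psi> 0 = (\<lambda>x. (d - 2 * p * k) * (\<lambda>(y, s). \<psi> y * \<rho> y s powr p) x + (\<lambda>(y, s). \<rho> y s powr p * (P y \<bullet> b y s)) x)"
      by (auto simp: \<Psi>_def)
    then show ?thesis
      by (simp only: integral_add[OF integrable_on_mult_right[OF 1] 2] integral_mult_right)
  qed
  ultimately show ?thesis
    unfolding Q_def by linarith
qed

end

lemma DERIV_max_0_power2:
  "((\<lambda>x::real. (max 0 x)\<^sup>2) has_real_derivative 2 * max 0 x) (at x)"
proof -
  consider "x > 0" | "x < 0" | "x = 0" by linarith
  then show ?thesis
  proof cases
    case 1
    have "((\<lambda>x::real. x\<^sup>2) has_real_derivative 2 * max 0 x) (at x)"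
      using 1 by (auto intro!: derivative_eq_intros)
    then show ?thesis
      by (rule has_field_derivative_transform_within_open[where S = "{0<..}"]) (use 1 in auto)
  next
    case 2
    have "((\<lambda>x::real. 0) has_real_derivative 2 * max 0 x) (at x)"
      using 2 by (auto intro!: derivative_eq_intros)
    then show ?thesis
      by (rule has_field_derivative_transform_within_open[where S = "{..<0}"]) (use 2 in auto)
  next
    case 3
    have "((\<lambda>h::real. (max 0 h)\<^sup>2 / h) \<longlongrightarrow> 0) (at 0)"
    proof (rule Lim_null_comparison)
      have "norm ((max 0 h)\<^sup>2 / h) \<le> \<bar>h\<bar>" for h :: real
        by (auto simp: max_def power2_eq_square)
      then show "\<forall>\<^sub>F h::real in at 0. norm ((max 0 h)\<^sup>2 / h) \<le> \<bar>h\<bar>" by simp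
      show "(abs \<longlongrightarrow> 0) (at (0::real))" by (auto intro!: tendsto_eq_intros)
    qed
    then show ?thesis using 3 by (simp add: DERIV_def)
  qed
qed

context transport
begin

text \<open>
  The cutoff \<open>\<eta>\<close>, a function of \<open>\<bar>y\<bar>\<^sup>2\<close>, selects a region into which the flow leads but which it does not
  leave: this is the hypothesis on the sign of \<open>\<eta>' * (b \<bullet> y)\<close>. It is multiplied by
  \<open>(max 0 (1 - \<bar>y\<bar>\<^sup>2 / N))\<^sup>2\<close> to obtain compact support. The flux which this second factor causes has the
  weight \<open>(1 + \<bar>y\<bar>\<^sup>2) / N * max 0 (1 - \<bar>y\<bar>\<^sup>2 / N)\<close>, up to a constant, because \<open>b \<bullet> y\<close> grows at most
  quadratically. The weight is bounded and tends to 0 pointwise as \<open>N\<close> grows, so dominated convergence,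
  with \<open>\<rho>\<^sup>p\<close> integrable, leaves a nonpositive integral of \<open>\<eta> \<rho>\<^sup>p\<close>.
\<close>

lemma vanishes_where_cutoff_positive:
  fixes \<eta> \<eta>' :: "real \<Rightarrow> real"
  assumes \<eta>: "\<And>t. (\<eta> has_real_derivative \<eta>' t) (at t)" and cont_\<eta>': "continuous_on UNIV \<eta>'"
    and \<eta>_bounds: "\<And>t. 0 \<le> \<eta> t" "\<And>t. \<eta> t \<le> 1"
    and growth: "\<And>y s. \<lbrakk>0 \<le> s; s \<le> S\<rbrakk> \<Longrightarrow> b y s \<bullet> y \<le> C * (1 + y \<bullet> y)" and C: "0 \<le> C"
    and outward: "\<And>y s. \<lbrakk>0 \<le> s; s \<le> S; \<rho> y s \<noteq> 0\<rbrakk> \<Longrightarrow> 0 \<le> \<eta>' (y \<bullet> y) * (b y s \<bullet> y)"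
    and decay: "\<And>y s. \<lbrakk>0 \<le> s; s \<le> S; \<eta> (y \<bullet> y) \<noteq> 0\<rbrakk> \<Longrightarrow> T y s + G y s \<bullet> b y s \<ge> - (2 * k * \<rho> y s)"
    and k: "0 \<le> k" and p: "0 < p" and expand: "2 * p * k < d"
    and int: "integrable lborel (\<lambda>(y, s). indicator {0..S} s * \<rho> y s powr p)"
    and y: "0 < \<eta> (y \<bullet> y)" and s: "0 < s" "s < S"
  shows "\<rho> y s = 0"
proof -
  \<comment> \<open>The shift by 1 keeps \<open>N\<close> at least 1, so that \<open>\<bar>y\<bar> > N\<close> implies \<open>\<bar>y\<bar>\<^sup>2 > N\<close>.\<close>
  define N where "N n = real n + 1" for n
  have N: "1 \<le> N n" for n by (simp add: N_def)
  then have N0: "0 < N n" for n using less_le_trans[OF zero_less_one] by blast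
  define \<zeta> where "\<zeta> n t = (max 0 (1 - t / N n))\<^sup>2" for n t
  define \<zeta>' where "\<zeta>' n t = - (2 / N n) * max 0 (1 - t / N n)" for n t
  have \<zeta>: "(\<zeta> n has_real_derivative \<zeta>' n t) (at t)" for n t
  proof -
    have "((\<lambda>t. (max 0 (1 - t / N n))\<^sup>2) has_real_derivative 2 * max 0 (1 - t / N n) * (- 1 / N n)) (at t)"
      by (rule DERIV_chain2[OF DERIV_max_0_power2]) (use N0[of n] in \<open>auto intro!: derivative_eq_intros\<close>)
    moreover have "\<zeta> n = (\<lambda>t. (max 0 (1 - t / N n))\<^sup>2)" by (simp add: \<zeta>_def fun_eq_iff)
    ultimately show ?thesis by (simp add: \<zeta>'_def mult_ac)
  qed
  have \<zeta>_bounds: "0 \<le> \<zeta> n (z \<bullet> z)" "\<zeta> n (z \<bullet> z) \<le> 1" for n and z :: 'a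
    using N0[of n] by (auto simp: \<zeta>_def intro!: power_le_one)
  have \<zeta>_supp: "\<zeta> n (z \<bullet> z) = 0" "\<zeta>' n (z \<bullet> z) = 0" if "N n < norm z" for n and z :: 'a
  proof -
    have "N n * 1 \<le> norm z * norm z"
      using that N[of n] by (intro mult_mono) auto
    then have "N n \<le> z \<bullet> z" by (simp add: dot_square_norm power2_eq_square)
    then show "\<zeta> n (z \<bullet> z) = 0" "\<zeta>' n (z \<bullet> z) = 0"
      using N0[of n] by (auto simp: \<zeta>_def \<zeta>'_def field_simps max_def)
  qed
  have cont_\<eta>: "continuous_on UNIV \<eta>"
    by (intro continuous_at_imp_continuous_on ballI DERIV_isCont[OF \<eta>])
  define \<psi> where "\<psi> n z = \<eta> (z \<bullet> z) * \<zeta> n (z \<bullet> z)" for n and z :: 'a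
  define P where "P n z = (2 * (\<eta>' (z \<bullet> z) * \<zeta> n (z \<bullet> z) + \<eta> (z \<bullet> z) * \<zeta>' n (z \<bullet> z))) *\<^sub>R z" for n and z :: 'a
  define u where "u = (\<lambda>(y, s). indicator {0..S} s * \<rho> y s powr p)"
  define w where "w n z = 4 * C * ((1 + z \<bullet> z) / N n * max 0 (1 - z \<bullet> z / N n))" for n and z :: 'a
  have cont_\<rho>p: "continuous_on A (\<lambda>x. \<rho> (f x) (h x) powr p)"
    if "continuous_on A f" "continuous_on A h" for A :: "('a \<times> real) set" and f h
    by (rule continuous_on_powr'[OF continuous_on_joint[OF cont_\<rho> that] continuous_on_const])
      (use \<rho>_nonneg p in auto)
  have cont_\<psi>: "continuous_on UNIV (\<psi> n)" for n
    unfolding \<psi>_def \<zeta>_def using N0[of n]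
    by (intro continuous_intros continuous_on_compose2[OF cont_\<eta>]) auto
  have cont_P: "continuous_on UNIV (P n)" for n
    unfolding P_def \<zeta>_def \<zeta>'_def using N0[of n]
    by (intro continuous_intros continuous_on_compose2[OF cont_\<eta>] continuous_on_compose2[OF cont_\<eta>']) auto
  have cont_w: "continuous_on UNIV (w n)" for n
    unfolding w_def using N0[of n] by (intro continuous_intros) auto
  have w_bounds: "0 \<le> w n z" "w n z \<le> 8 * C" for n z
  proof -
    have "(1 + z \<bullet> z) / N n * max 0 (1 - z \<bullet> z / N n) \<le> 2"
    proof (cases "z \<bullet> z \<le> N n")
      case True
      have "(1 + z \<bullet> z) / N n * max 0 (1 - z \<bullet> z / N n) \<le> 2 * 1"
        using True N[of n] N0[of n] by (intro mult_mono) (auto simp: field_simps)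
      then show ?thesis by simp
    next
      case False
      then have "max 0 (1 - z \<bullet> z / N n) = 0" using N0[of n] by (auto simp: field_simps max_def)
      then show ?thesis by simp
    qed
    from mult_left_mono[OF this, of "4 * C"] C show "w n z \<le> 8 * C" by (simp add: w_def)
    show "0 \<le> w n z" using C N0[of n] by (auto simp: w_def intro!: mult_nonneg_nonneg divide_nonneg_nonneg add_nonneg_nonneg)
  qed
  have meas_u: "u \<in> borel_measurable lborel"
    using int by (simp add: u_def)
  have u_nonneg: "0 \<le> u x" for x by (auto simp: u_def split: prod.splits)
  have meas1: "(\<lambda>x. f (fst x)) \<in> borel_measurable lborel" if "continuous_on UNIV f"
    for f :: "'a \<Rightarrow> real"
    using continuous_on_compose2[OF that continuous_on_fst[OF continuous_on_id]]
    by (auto intro!: borel_measurable_continuous_onI)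
  have int_bdd: "integrable lborel (\<lambda>x. u x * f (fst x))"
    if "continuous_on UNIV f" "\<And>z. \<bar>f z\<bar> \<le> B" for f :: "'a \<Rightarrow> real" and B
  proof (rule Bochner_Integration.integrable_bound)
    show "integrable lborel (\<lambda>x. B * u x)" using int by (simp add: u_def)
    show "(\<lambda>x. u x * f (fst x)) \<in> borel_measurable lborel"
      by (rule borel_measurable_times[OF meas_u meas1[OF that(1)]])
    have "\<bar>u x * f (fst x)\<bar> \<le> \<bar>B * u x\<bar>" for x
    proof -
      have "\<bar>u x * f (fst x)\<bar> = u x * \<bar>f (fst x)\<bar>" using u_nonneg[of x] by (simp add: abs_mult)
      also have "\<dots> \<le> u x * B" by (intro mult_left_mono that u_nonneg)
      finally show ?thesis by (simp add: mult.commute)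
    qed
    then show "AE x in lborel. norm (u x * f (fst x)) \<le> norm (B * u x)" by simp
  qed
  have main: "(d - 2 * p * k) * (LINT x|lborel. u x * \<psi> n (fst x)) \<le> (LINT x|lborel. u x * w n (fst x))" for n
  proof -
    obtain a where a: "cball 0 (N n + 1) \<subseteq> cbox (- a) (a :: 'a)"
      using bounded_subset_cbox_symmetric[OF bounded_cball] by blast
    define Q where "Q = cbox (- a, 0) (a, S)"
    have lebesgue: "integral Q (\<lambda>(y, s). f y s) = (LINT x|lborel. indicator {0..S} (snd x) * f (fst x) (snd x))"
      "integrable lborel (\<lambda>x. indicator {0..S} (snd x) * f (fst x) (snd x))"
      if "continuous_on UNIV (\<lambda>(y, s). f y s)" "\<And>y s. N n < norm y \<Longrightarrow> f y s = 0" for f :: "'a \<Rightarrow> real \<Rightarrow> real"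
    proof -
      have "set_integrable lborel Q (\<lambda>(y, s). f y s)"
        unfolding set_integrable_def Q_def
        by (intro borel_integrable_compact compact_cbox continuous_on_subset[OF that(1)]) auto
      moreover have "indicator Q x *\<^sub>R (\<lambda>(y, s). f y s) x = indicator {0..S} (snd x) * f (fst x) (snd x)" for x
      proof (cases "f (fst x) (snd x) = 0")
        case False
        then have "norm (fst x) \<le> N n + 1" using that(2) by force
        then have "fst x \<in> cbox (- a) a" using a by auto
        then show ?thesis by (cases x) (auto simp: Q_def indicator_def cbox_Pair_eq)
      qed (auto simp: split_beta)
      ultimately show "integral Q (\<lambda>(y, s). f y s) = (LINT x|lborel. indicator {0..S} (snd x) * f (fst x) (snd x))"
        "integrable lborel (\<lambda>x. indicator {0..S} (snd x) * f (fst x) (snd x))"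
        using set_borel_integral_eq_integral(2)[of Q "\<lambda>(y, s). f y s"]
        by (simp_all add: set_integrable_def set_lebesgue_integral_def)
    qed
    have P: "(\<psi> n has_derivative (\<lambda>v. P n z \<bullet> v)) (at z)" for z
    proof -
      have "((\<lambda>t. \<eta> t * \<zeta> n t) has_real_derivative \<eta>' t * \<zeta> n t + \<eta> t * \<zeta>' n t) (at t)" for t
        by (auto intro!: derivative_eq_intros \<eta> \<zeta>)
      note D = this[unfolded has_field_derivative_def]
      have "((\<lambda>z::'a. z \<bullet> z) has_derivative (\<lambda>v. 2 * (z \<bullet> v))) (at z)"
        by (auto intro!: derivative_eq_intros simp: inner_commute)
      from has_derivative_compose[OF this D]
      show ?thesis
        unfolding \<psi>_def P_def by (rule has_derivative_eq_rhs) (simp add: algebra_simps fun_eq_iff)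
    qed
    have "(d - 2 * p * k) * integral Q (\<lambda>(y, s). \<psi> n y * \<rho> y s powr p)
      \<le> - integral Q (\<lambda>(y, s). \<rho> y s powr p * (P n y \<bullet> b y s))"
      unfolding Q_def
    proof (rule transport_inequality[OF P cont_P _ _ a _ k p])
      show "0 \<le> \<psi> n y" for y using \<eta>_bounds \<zeta>_bounds by (simp add: \<psi>_def)
      show "\<psi> n y = 0" if "N n < norm y" for y using \<zeta>_supp[OF that] by (simp add: \<psi>_def)
      show "- (2 * k * \<rho> y s) \<le> T y s + G y s \<bullet> b y s" if "0 \<le> s" "s \<le> S" "\<psi> n y \<noteq> 0" for y s
        using decay that by (auto simp: \<psi>_def)
    qed
    moreover have "integral Q (\<lambda>(y, s). \<psi> n y * \<rho> y s powr p) = (LINT x|lborel. u x * \<psi> n (fst x))"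
    proof (subst lebesgue)
      show "continuous_on UNIV (\<lambda>(y, s). \<psi> n y * \<rho> y s powr p)"
        unfolding split_beta
        by (intro continuous_on_mult cont_\<rho>p continuous_on_compose2[OF cont_\<psi>] continuous_intros) auto
      show "\<psi> n y * \<rho> y s powr p = 0" if "N n < norm y" for y s
        using \<zeta>_supp[OF that] by (simp add: \<psi>_def)
    qed (simp add: u_def split_beta mult_ac)
    moreover have "- integral Q (\<lambda>(y, s). \<rho> y s powr p * (P n y \<bullet> b y s)) \<le> (LINT x|lborel. u x * w n (fst x))"
    proof -
      have c: "continuous_on UNIV (\<lambda>(y, s). \<rho> y s powr p * (P n y \<bullet> b y s))"
        unfolding split_beta
        by (intro continuous_on_mult cont_\<rho>p continuous_on_inner continuous_on_compose2[OF cont_P]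
            continuous_on_joint[OF cont_b] continuous_intros) auto
      have z: "\<rho> y s powr p * (P n y \<bullet> b y s) = 0" if "N n < norm y" for y s
        using \<zeta>_supp[OF that] by (simp add: P_def)
      have "- integral Q (\<lambda>(y, s). \<rho> y s powr p * (P n y \<bullet> b y s))
        = (LINT x|lborel. - (indicator {0..S} (snd x) * (\<rho> (fst x) (snd x) powr p * (P n (fst x) \<bullet> b (fst x) (snd x)))))"
        by (simp add: lebesgue(1)[OF c z])
      also have "\<dots> \<le> (LINT x|lborel. u x * w n (fst x))"
      proof (rule integral_mono)
        show "integrable lborel (\<lambda>x. - (indicator {0..S} (snd x) * (\<rho> (fst x) (snd x) powr p * (P n (fst x) \<bullet> b (fst x) (snd x)))))"
          using lebesgue(2)[OF c z] by simp
        show "integrable lborel (\<lambda>x. u x * w n (fst x))"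
          using w_bounds by (intro int_bdd[of "w n" "8 * C"] cont_w) (auto simp: abs_of_nonneg)
        fix x :: "'a \<times> real"
        obtain z t where x: "x = (z, t)" by (cases x)
        show "- (indicator {0..S} (snd x) * (\<rho> (fst x) (snd x) powr p * (P n (fst x) \<bullet> b (fst x) (snd x)))) \<le> u x * w n (fst x)"
        proof (cases "t \<in> {0..S} \<and> \<rho> z t \<noteq> 0")
          case True
          then have t: "0 \<le> t" "t \<le> S" and nz: "\<rho> z t \<noteq> 0" by auto
          have "- (P n z \<bullet> b z t) = - 2 * (\<zeta> n (z \<bullet> z) * (\<eta>' (z \<bullet> z) * (b z t \<bullet> z)))
              + 4 * (\<eta> (z \<bullet> z) * (max 0 (1 - z \<bullet> z / N n) / N n) * (b z t \<bullet> z))"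
            by (simp add: P_def \<zeta>'_def algebra_simps inner_commute)
          also have "\<dots> \<le> 0 + 4 * (1 * (max 0 (1 - z \<bullet> z / N n) / N n) * (C * (1 + z \<bullet> z)))"
          proof (intro add_mono mult_left_mono)
            show "- 2 * (\<zeta> n (z \<bullet> z) * (\<eta>' (z \<bullet> z) * (b z t \<bullet> z))) \<le> 0"
              using \<zeta>_bounds(1)[of n z] outward[OF t nz] by simp
            have nn: "0 \<le> max 0 (1 - z \<bullet> z / N n) / N n" using N0[of n] by simp
            have "\<eta> (z \<bullet> z) * (max 0 (1 - z \<bullet> z / N n) / N n) * (b z t \<bullet> z)
               \<le> \<eta> (z \<bullet> z) * (max 0 (1 - z \<bullet> z / N n) / N n) * (C * (1 + z \<bullet> z))"
              using nn \<eta>_bounds(1) by (intro mult_left_mono growth t mult_nonneg_nonneg)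
            also have "\<dots> \<le> 1 * (max 0 (1 - z \<bullet> z / N n) / N n) * (C * (1 + z \<bullet> z))"
              using nn C \<eta>_bounds by (intro mult_right_mono mult_nonneg_nonneg) auto
            finally show "\<eta> (z \<bullet> z) * (max 0 (1 - z \<bullet> z / N n) / N n) * (b z t \<bullet> z)
               \<le> 1 * (max 0 (1 - z \<bullet> z / N n) / N n) * (C * (1 + z \<bullet> z))" .
          qed auto
          also have "\<dots> = w n z" by (simp add: w_def mult_ac)
          finally have "\<rho> z t powr p * (- (P n z \<bullet> b z t)) \<le> \<rho> z t powr p * w n z"
            by (intro mult_left_mono) auto
          then show ?thesis using t by (simp add: x u_def)
        qed (use p in \<open>auto simp: x u_def\<close>)
      qed
      finally show ?thesis .
    qed
    ultimately show ?thesis by simp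
  qed
  have inv_N: "(\<lambda>n. c / N n) \<longlonglongrightarrow> 0" for c
    unfolding N_def using tendsto_mult[OF tendsto_const LIMSEQ_inverse_real_of_nat, of c]
    by (simp add: divide_inverse add.commute)
  have lim_\<psi>: "(\<lambda>n. LINT x|lborel. u x * \<psi> n (fst x)) \<longlonglongrightarrow> (LINT x|lborel. u x * \<eta> (fst x \<bullet> fst x))"
  proof (rule integral_dominated_convergence[where w = u])
    show "(\<lambda>x. u x * \<eta> (fst x \<bullet> fst x)) \<in> borel_measurable lborel"
      using meas_u by (intro borel_measurable_times meas1[of "\<lambda>z. \<eta> (z \<bullet> z)"] continuous_on_compose2[OF cont_\<eta>] continuous_intros) auto
    show "(\<lambda>x. u x * \<psi> n (fst x)) \<in> borel_measurable lborel" for n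
      using meas_u by (intro borel_measurable_times meas1 cont_\<psi>)
    show "integrable lborel u" using int by (simp add: u_def)
    have "(\<lambda>n. u x * \<psi> n (fst x)) \<longlonglongrightarrow> u x * (\<eta> (fst x \<bullet> fst x) * (max 0 (1 - 0))\<^sup>2)" for x
      unfolding \<psi>_def \<zeta>_def by (intro tendsto_intros inv_N)
    then show "AE x in lborel. (\<lambda>n. u x * \<psi> n (fst x)) \<longlonglongrightarrow> u x * \<eta> (fst x \<bullet> fst x)" by simp
    have "norm (u x * \<psi> n (fst x)) \<le> u x" for n x
    proof -
      have "\<psi> n (fst x) \<le> 1" "0 \<le> \<psi> n (fst x)"
        using \<eta>_bounds \<zeta>_bounds by (auto simp: \<psi>_def intro!: mult_le_one)
      then show ?thesis using u_nonneg[of x] by (simp add: abs_mult mult_left_le)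
    qed
    then show "AE x in lborel. norm (u x * \<psi> n (fst x)) \<le> u x" for n by simp
  qed
  have "(\<lambda>n. LINT x|lborel. u x * w n (fst x)) \<longlonglongrightarrow> (LINT x|(lborel :: ('a \<times> real) measure). 0)"
  proof (rule integral_dominated_convergence[where w = "\<lambda>x. 8 * C * u x"])
    show "(\<lambda>x. u x * w n (fst x)) \<in> borel_measurable lborel" for n
      using meas_u by (intro borel_measurable_times meas1 cont_w)
    show "integrable lborel (\<lambda>x. 8 * C * u x)" using int by (simp add: u_def)
    have "(\<lambda>n. u x * w n (fst x)) \<longlonglongrightarrow> u x * (4 * C * (0 * max 0 (1 - 0)))" for x
      unfolding w_def by (intro tendsto_intros inv_N)
    then show "AE x in lborel. (\<lambda>n. u x * w n (fst x)) \<longlonglongrightarrow> 0" by simp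
    have "norm (u x * w n (fst x)) \<le> 8 * C * u x" for n x
      using w_bounds[of n "fst x"] u_nonneg[of x] mult_left_mono[of "w n (fst x)" "8 * C" "u x"]
      by (simp add: abs_mult mult.commute)
    then show "AE x in lborel. norm (u x * w n (fst x)) \<le> 8 * C * u x" for n by simp
  qed simp
  then have "(d - 2 * p * k) * (LINT x|lborel. u x * \<eta> (fst x \<bullet> fst x)) \<le> 0"
    using LIMSEQ_le[OF tendsto_mult[OF tendsto_const lim_\<psi>]] main by simp
  then have "(LINT x|lborel. u x * \<eta> (fst x \<bullet> fst x)) \<le> 0"
    using expand by (simp add: mult_le_0_iff)
  moreover have "0 \<le> (LINT x|lborel. u x * \<eta> (fst x \<bullet> fst x))"
    using u_nonneg \<eta>_bounds by (intro integral_nonneg_AE) auto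
  moreover have "integrable lborel (\<lambda>x. u x * \<eta> (fst x \<bullet> fst x))"
    using \<eta>_bounds
    by (intro int_bdd[of "\<lambda>z. \<eta> (z \<bullet> z)" 1] continuous_on_compose2[OF cont_\<eta>] continuous_intros) (auto simp: abs_of_nonneg)
  ultimately have ae: "AE x in lborel. u x * \<eta> (fst x \<bullet> fst x) = 0"
    using u_nonneg \<eta>_bounds by (subst integral_nonneg_eq_0_iff_AE[symmetric]) auto
  \<comment> \<open>An open set of measure 0 is empty, which turns the almost everywhere statement into one at \<open>(y, s)\<close>.\<close>
  define E where "E = {x. 0 < snd x \<and> snd x < S \<and> 0 < \<rho> (fst x) (snd x) \<and> 0 < \<eta> (fst x \<bullet> fst x)}"
  have "open E"
    unfolding E_def
    by (intro open_Collect_conj open_Collect_less continuous_on_joint[OF cont_\<rho>]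
        continuous_on_compose2[OF cont_\<eta>] continuous_intros) auto
  moreover have "AE x in lborel. x \<notin> E"
    using ae by eventually_elim (auto simp: E_def u_def split_beta)
  then have "E \<in> null_sets lborel"
    using \<open>open E\<close> by (subst AE_iff_null_sets) auto
  then have "negligible E"
    by (simp add: negligible_iff_null_sets null_sets_completionI)
  ultimately have "E = {}" using open_not_negligible by blast
  then have "(y, s) \<notin> E" by simp
  then show ?thesis using y s \<rho>_nonneg[of y s] by (auto simp: E_def)
qed

end

section \<open>The transport form of the equation\<close>

text \<open>
  The curl of a field depends linearly on its derivative alone. As a function of that derivative it
  can be differentiated once more, which gives the derivative of \<open>J\<close>.
\<close>

definition curl_map :: "(real^3 \<Rightarrow> real^3) \<Rightarrow> real^3" where
  "curl_map A = (A (axis 2 1) $ 3 - A (axis 3 1) $ 2) *\<^sub>R axis 1 1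
     + (A (axis 3 1) $ 1 - A (axis 1 1) $ 3) *\<^sub>R axis 2 1
     + (A (axis 1 1) $ 2 - A (axis 2 1) $ 1) *\<^sub>R axis 3 1"

lemma curl_map_components:
  "curl_map A $ 1 = A (axis 2 1) $ 3 - A (axis 3 1) $ 2"
  "curl_map A $ 2 = A (axis 3 1) $ 1 - A (axis 1 1) $ 3"
  "curl_map A $ 3 = A (axis 1 1) $ 2 - A (axis 2 1) $ 1"
  by (simp_all add: curl_map_def axis_def)

lemma bounded_linear_curl_map: "bounded_linear (\<lambda>A. curl_map (blinfun_apply A))"
  unfolding curl_map_def
  by (intro bounded_linear_add bounded_linear_sub bounded_linear_scaleR_const
      bounded_linear_compose[OF bounded_linear_vec_nth] blinfun.bounded_linear_left)

lemma jacobian_eq_matrix: "(F has_derivative f) (at y) \<Longrightarrow> jacobian F (at y) = matrix f"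
  by (simp add: jacobian_def frechet_derivative_at[symmetric])

lemma curl_eq_curl_map: "(F has_derivative f) (at y) \<Longrightarrow> curl F y = curl_map f"
  by (simp add: curl_def jacobian_eq_matrix Let_def vec_eq_iff forall_3 curl_map_components matrix_def)

lemma divergence_eq_trace: "(F has_derivative f) (at y) \<Longrightarrow> divergence F y = (\<Sum>i\<in>UNIV. f (axis i 1) $ i)"
  by (simp add: divergence_def jacobian_eq_matrix trace_def matrix_def)

lemma sum_Basis_inner_real3: "(\<Sum>i\<in>Basis. (f i :: real^3) \<bullet> i) = (\<Sum>i\<in>UNIV. f (axis i 1) $ i)"
proof -
  have B: "(Basis :: (real^3) set) = (\<lambda>i. axis i 1) ` UNIV" by (auto simp: Basis_vec_def)
  have "inj (\<lambda>i::3. axis i 1 :: real^3)" by (auto simp: inj_def axis_eq_axis)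
  then show ?thesis unfolding B by (simp add: sum.reindex inner_axis)
qed

lemma linear_real3: "linear A \<Longrightarrow> A v = v $ 1 *\<^sub>R A (axis 1 1) + v $ 2 *\<^sub>R A (axis 2 1) + v $ 3 *\<^sub>R A (axis 3 1)"
  for A :: "real^3 \<Rightarrow> real^3"
proof -
  assume A: "linear A"
  have "v = v $ 1 *\<^sub>R axis 1 1 + v $ 2 *\<^sub>R axis 2 1 + v $ 3 *\<^sub>R axis 3 1"
    by (simp add: vec_eq_iff forall_3 axis_def)
  then have "A v = A (v $ 1 *\<^sub>R axis 1 1 + v $ 2 *\<^sub>R axis 2 1 + v $ 3 *\<^sub>R axis 3 1)" by simp
  then show ?thesis by (simp add: linear_add[OF A] linear_scale[OF A])
qed

text \<open>
  The identity for the curl of a cross product, stated for the values \<open>j\<close>, \<open>h\<close> of the two factors and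
  their derivatives \<open>B\<close>, \<open>A\<close>, whose traces are the divergences.
\<close>

lemma curl_map_cross3:
  assumes A: "linear A" and B: "linear B"
  shows "curl_map (\<lambda>v. cross3 j (A v) + cross3 (B v) h)
    = B h - A j + (\<Sum>i\<in>UNIV. A (axis i 1) $ i) *\<^sub>R j - (\<Sum>i\<in>UNIV. B (axis i 1) $ i) *\<^sub>R h"
  unfolding linear_real3[OF A, of j] linear_real3[OF B, of h]
  by (simp add: vec_eq_iff forall_3 curl_map_components cross_components sum_3 algebra_simps)

text \<open>
  For a divergence-free field \<open>h\<close> with curl \<open>J\<close> both divergence terms of the preceding identity drop out,
  that of \<open>J\<close> by the symmetry of second derivatives, and \<open>curl (J \<times> h) = (h . grad) J - (J . grad) h\<close>
  remains.
\<close>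

lemma
  fixes h :: "real^3 \<Rightarrow> real^3"
    and D :: "real^3 \<Rightarrow> (real^3) \<Rightarrow>\<^sub>L (real^3)"
    and D2 :: "real^3 \<Rightarrow> (real^3) \<Rightarrow>\<^sub>L ((real^3) \<Rightarrow>\<^sub>L (real^3))"
  assumes h: "\<And>y. (h has_derivative blinfun_apply (D y)) (at y)"
    and D: "\<And>y. (D has_derivative blinfun_apply (D2 y)) (at y)"
    and cont: "continuous_on UNIV D2"
  shows curl_has_derivative: "(curl h has_derivative (\<lambda>v. curl_map (D2 y v))) (at y)"
    and divergence_curl: "(\<Sum>i\<in>UNIV. curl_map (D2 y (axis i 1)) $ i) = 0"
    and curl_cross3_curl: "divergence h y = 0 \<Longrightarrow> curl (\<lambda>z. cross3 (curl h z) (h z)) y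
      = curl_map (D2 y (h y)) - D y (curl h y)"
proof -
  have sym: "D2 y u v $ i = D2 y v u $ i" for u v i
  proof (rule symmetric_second_derivative[where f = "\<lambda>z. h z $ i" and f' = "\<lambda>z v. D z v $ i" and f'' = "\<lambda>z u v. D2 z u v $ i"])
    show "((\<lambda>z. h z $ i) has_derivative (\<lambda>v. D x v $ i)) (at x)" for x
      by (rule bounded_linear.has_derivative[OF bounded_linear_vec_nth h])
    show "((\<lambda>z. D z u $ i) has_derivative (\<lambda>v. D2 x v u $ i)) (at x)" for x u
      by (rule bounded_linear.has_derivative[OF bounded_linear_compose[OF bounded_linear_vec_nth blinfun.bounded_linear_left] D])
    show "continuous_on UNIV (\<lambda>x. D2 x v u $ i)" for u v
      by (intro continuous_intros cont)
  qed
  show div: "(\<Sum>i\<in>UNIV. curl_map (D2 y (axis i 1)) $ i) = 0"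
    using sym[of "axis 1 1" "axis 2 1"] sym[of "axis 1 1" "axis 3 1"] sym[of "axis 2 1" "axis 3 1"]
    by (simp add: sum_3 curl_map_components)
  have curl: "curl h = (\<lambda>y. curl_map (D y))"
    using curl_eq_curl_map[OF h] by (simp add: fun_eq_iff)
  show dc: "(curl h has_derivative (\<lambda>v. curl_map (D2 y v))) (at y)"
    unfolding curl by (rule bounded_linear.has_derivative[OF bounded_linear_curl_map D])
  assume "divergence h y = 0"
  then have "(\<Sum>i\<in>UNIV. D y (axis i 1) $ i) = 0"
    by (simp add: divergence_eq_trace[OF h])
  moreover have "curl (\<lambda>z. cross3 (curl h z) (h z)) y
      = curl_map (\<lambda>v. cross3 (curl h y) (D y v) + cross3 (curl_map (D2 y v)) (h y))"
    using bilinear_cross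
    by (intro curl_eq_curl_map bounded_bilinear.FDERIV[OF _ dc h]) (simp add: bilinear_conv_bounded_bilinear)
  ultimately show "curl (\<lambda>z. cross3 (curl h z) (h z)) y = curl_map (D2 y (h y)) - D y (curl h y)"
    using div has_derivative_linear[OF h] has_derivative_linear[OF dc]
    by (simp add: curl_map_cross3)
qed

section \<open>Consequences of integrability and of decay at infinity\<close>

lemma norm_matrix_vector_mult_le: "norm (A *v x) \<le> norm A * norm x" for A :: "real^'n^'m"
proof -
  have "norm (A *v x) \<le> L2_set (\<lambda>i. norm (A $ i) * norm x) UNIV"
    unfolding norm_vec_def[of "A *v x"]
    by (intro L2_set_mono) (auto simp: matrix_vector_mul_component Cauchy_Schwarz_ineq2)
  also have "\<dots> = norm A * norm x"
    by (simp add: norm_vec_def[of A] L2_set_left_distrib)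
  finally show ?thesis .
qed

lemma in_Lq_imp_integrable:
  fixes H :: "real^3 \<Rightarrow> real \<Rightarrow> real^3"
  assumes cont: "continuous_on UNIV (\<lambda>(y, s). H y s)" and q: "0 < q" and H: "in_Lq q S H"
  shows "integrable lborel (\<lambda>(y, s). indicator {0..S} s * (H y s \<bullet> H y s) powr (q / 2))"
proof -
  have eq: "(H y s \<bullet> H y s) powr (q / 2) = norm (H y s) powr q" for y s
    by (cases "H y s = 0") (simp_all add: dot_square_norm powr_powr flip: powr_numeral)
  let ?f = "\<lambda>(y, s). indicator {0..S} s * norm (H y s) powr q"
  have meas: "?f \<in> borel_measurable (lborel :: ((real^3) \<times> real) measure)"
  proof -
    have "continuous_on UNIV (\<lambda>x. norm (H (fst x) (snd x)) powr q)"
      using q by (intro continuous_on_powr' continuous_intros continuous_on_joint[OF cont]) auto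
    then have "(\<lambda>x. norm (H (fst x) (snd x)) powr q) \<in> borel_measurable borel"
      by (rule borel_measurable_continuous_onI)
    moreover have "(\<lambda>x. indicator {0..S} (snd x) :: real) \<in> borel_measurable (borel :: ((real^3) \<times> real) measure)"
    proof -
      have "(\<lambda>x. indicator {0..S} (snd x) :: real) = indicator ((UNIV :: (real^3) set) \<times> {0..S})"
        by (auto simp: indicator_def)
      then show ?thesis by (simp add: borel_measurable_indicator borel_closed closed_Times)
    qed
    ultimately show ?thesis by (simp add: split_beta)
  qed
  have "(\<integral>\<^sup>+x. ennreal (norm (?f x)) \<partial>lborel) = (\<integral>\<^sup>+s. \<integral>\<^sup>+y. ennreal (norm (?f (y, s))) \<partial>lborel \<partial>lborel)"
    unfolding lborel_prod[symmetric]
    by (rule lborel_pair.nn_integral_snd[symmetric]) (use meas in \<open>simp add: lborel_prod\<close>)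
  also have "\<dots> = (\<integral>\<^sup>+s\<in>{0..S}. \<integral>\<^sup>+y. ennreal (norm (H y s) powr q) \<partial>lborel \<partial>lborel)"
    by (intro nn_integral_cong) (auto simp: indicator_def)
  also have "\<dots> < \<infinity>" using H by (simp add: in_Lq_def)
  finally show ?thesis
    using meas by (simp add: integrable_iff_bounded eq)
qed

text \<open>
  A real supremum bounds the members of its set only if that set is bounded above. This follows from
  continuity on the compact period, which also extends the bound to the end points.
\<close>

lemma bounded_outside_ball_of_SUP_tendsto_0:
  fixes m :: "'a::real_normed_vector \<Rightarrow> real \<Rightarrow> real"
  assumes cont: "\<And>y. continuous_on UNIV (m y)" and S: "0 < S"
    and lim: "((\<lambda>y. SUP s\<in>{0<..<S}. m y s) \<longlongrightarrow> 0) at_infinity" and \<epsilon>: "0 < \<epsilon>"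
  obtains R where "1 \<le> R" "\<And>y s. \<lbrakk>R \<le> norm y; 0 \<le> s; s \<le> S\<rbrakk> \<Longrightarrow> m y s \<le> \<epsilon>"
proof -
  have "\<forall>\<^sub>F y in at_infinity. dist (SUP s\<in>{0<..<S}. m y s) 0 < \<epsilon>"
    using lim \<epsilon> by (rule tendstoD)
  then obtain R where R: "\<And>y. R \<le> norm y \<Longrightarrow> \<bar>SUP s\<in>{0<..<S}. m y s\<bar> < \<epsilon>"
    by (auto simp: eventually_at_infinity)
  have "m y s \<le> \<epsilon>" if y: "max 1 R \<le> norm y" and s: "0 \<le> s" "s \<le> S" for y s
  proof -
    have "bdd_above (m y ` {0..S})"
      by (intro bounded_imp_bdd_above compact_imp_bounded compact_continuous_image
          continuous_on_subset[OF cont]) auto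
    then have bdd: "bdd_above (m y ` {0<..<S})"
      by (rule bdd_above_mono) auto
    have "m y t \<le> \<epsilon>" if "t \<in> {0<..<S}" for t
      using cSUP_upper[OF that bdd] R[of y] y by simp
    then have "{0<..<S} \<subseteq> {t. m y t \<le> \<epsilon>}" by auto
    moreover have "closed {t. m y t \<le> \<epsilon>}"
      by (intro closed_Collect_le cont continuous_on_const)
    ultimately have "closure {0<..<S} \<subseteq> {t. m y t \<le> \<epsilon>}" by (rule closure_minimal)
    then show ?thesis using s S by (auto simp: closure_greaterThanLessThan)
  qed
  then show ?thesis by (intro that[of "max 1 R"]) auto
qed

section \<open>Vanishing of periodic solutions\<close>

theorem theorem1p3:
  fixes \<alpha> S\<^sub>0 :: real
    and H J :: "real^3 \<Rightarrow> real \<Rightarrow> real^3"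
  assumes "S\<^sub>0 > 0"
    and "C2y_C1s H"
    and "\<And>y s. H y (s + S\<^sub>0) = H y s"
    and "\<And>y s. vector_derivative (\<lambda>t. H y t) (at s)
           + (\<alpha> / (\<alpha> + 2)) *\<^sub>R H y s
           + (1 / (\<alpha> + 2)) *\<^sub>R advect y (\<lambda>z. H z s) y
           + curl (\<lambda>z. cross3 (curl (\<lambda>x. H x s) z) (H z s)) y = 0"
    and "\<And>y s. divergence (\<lambda>z. H z s) y = 0"
    and "\<And>y s. J y s = curl (\<lambda>z. H z s) y"
    and "((\<lambda>y. SUP s\<in>{0<..<S\<^sub>0}. norm (J y s) + norm (jacobian (\<lambda>z. J z s) (at y))) \<longlongrightarrow> 0) at_infinity"
    and "(\<alpha> > 0 \<and> (\<exists>q. 0 < q \<and> q < 3 / \<alpha> \<and> in_Lq q S\<^sub>0 H)) \<or>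
         (-2 < \<alpha> \<and> \<alpha> \<le> 0 \<and> (\<exists>q>0. in_Lq q S\<^sub>0 H))"
  shows "\<forall>y s. H y s = 0"
proof -
  define S where "S = S\<^sub>0"
  define \<beta> where "\<beta> = 1 / (\<alpha> + 2)"
  \<comment> \<open>\<open>\<gamma>\<close> bounds the decay of \<open>\<bar>H\<bar>\<close> along the flow that the zeroth-order term causes; for
    \<open>\<alpha> \<le> 0\<close> this term causes none.\<close>
  define \<gamma> where "\<gamma> = max 0 (\<alpha> / (\<alpha> + 2))"
  have S: "0 < S" using assms(1) by (simp add: S_def)
  have \<alpha>: "0 < \<alpha> + 2" using assms(8) by auto
  have \<beta>: "0 < \<beta>" using \<alpha> by (simp add: \<beta>_def)
  have \<gamma>: "0 \<le> \<gamma>" "\<alpha> / (\<alpha> + 2) \<le> \<gamma>" by (auto simp: \<gamma>_def)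
  obtain q where q: "0 < q" "in_Lq q S H" and q\<gamma>: "q * \<gamma> < 3 * \<beta>"
  proof -
    from assms(8) obtain q where q: "0 < q" "in_Lq q S\<^sub>0 H" "0 < \<alpha> \<longrightarrow> q < 3 / \<alpha>" by auto
    have "q * \<gamma> < 3 * \<beta>"
    proof (cases "0 < \<alpha>")
      case True
      then have "q * \<alpha> * \<beta> < 3 * \<beta>" using q \<beta> by (intro mult_strict_right_mono) (auto simp: field_simps)
      then show ?thesis using True by (simp add: \<gamma>_def \<beta>_def)
    next
      case False
      then have "\<alpha> / (\<alpha> + 2) \<le> 0" using \<alpha> by (intro divide_nonpos_pos) auto
      then have "\<gamma> = 0" by (simp add: \<gamma>_def)
      then show ?thesis using \<beta> by simp
    qed
    with q show ?thesis by (intro that) (auto simp: S_def)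
  qed
  from assms(2) obtain D :: "real^3 \<Rightarrow> real \<Rightarrow> ((real^3) \<Rightarrow>\<^sub>L (real^3))"
     and D2 :: "real^3 \<Rightarrow> real \<Rightarrow> ((real^3) \<Rightarrow>\<^sub>L ((real^3) \<Rightarrow>\<^sub>L (real^3)))"
     and Ds :: "real^3 \<Rightarrow> real \<Rightarrow> real^3"
    where cont_H: "continuous_on UNIV (\<lambda>(y, s). H y s)"
     and D: "\<And>y s. ((\<lambda>z. H z s) has_derivative blinfun_apply (D y s)) (at y)"
     and D2: "\<And>y s. ((\<lambda>z. D z s) has_derivative blinfun_apply (D2 y s)) (at y)"
     and Ds: "\<And>y s. ((\<lambda>t. H y t) has_vector_derivative Ds y s) (at s)"
     and cont_D: "continuous_on UNIV (\<lambda>(y, s). D y s)"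
     and cont_D2: "continuous_on UNIV (\<lambda>(y, s). D2 y s)"
     and cont_Ds: "continuous_on UNIV (\<lambda>(y, s). Ds y s)"
    unfolding C2y_C1s_def by metis
  note cont_intros = continuous_on_joint[OF cont_H] continuous_on_joint[OF cont_D]
    continuous_on_joint[OF cont_D2] continuous_on_joint[OF cont_Ds]
  define J' where "J' y s v = curl_map (D2 y s v)" for y s v
  have J_eq: "J y s = curl_map (D y s)" for y s
    using assms(6) curl_eq_curl_map[OF D] by simp
  have J_curl: "(\<lambda>z. J z s) = curl (\<lambda>z. H z s)" for s
    using assms(6) by (simp add: fun_eq_iff)
  have cont_D2s: "continuous_on UNIV (\<lambda>y. D2 y s)" for s
    by (intro cont_intros continuous_intros)
  have J': "((\<lambda>z. J z s) has_derivative J' y s) (at y)" for y s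
    unfolding J_curl J'_def using curl_has_derivative[OF D D2 cont_D2s] .
  have lin_J': "linear (J' y s)" for y s using has_derivative_linear[OF J'] .
  have div_J: "(\<Sum>i\<in>Basis. J' y s i \<bullet> i) = 0" for y s
    unfolding sum_Basis_inner_real3 J'_def using divergence_curl[OF D D2 cont_D2s] .
  have cont_J: "continuous_on UNIV (\<lambda>(y, s). J y s)"
    unfolding J_eq curl_map_def split_beta by (intro continuous_intros cont_intros)
  have cont_J': "continuous_on UNIV (\<lambda>(y, s). J' y s v)" for v
    unfolding J'_def curl_map_def split_beta by (intro continuous_intros cont_intros)
  define m where "m y s = norm (J y s) + norm (matrix (J' y s))" for y s
  have cont_m: "continuous_on UNIV (\<lambda>(y, s). m y s)"
    unfolding m_def matrix_def split_beta
    by (intro continuous_intros continuous_on_joint[OF cont_J] continuous_on_joint[OF cont_J'])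
  have m: "norm (J y s) \<le> m y s" "norm (J' y s v) \<le> m y s * norm v" for y s v
  proof -
    show "norm (J y s) \<le> m y s" by (simp add: m_def)
    have "norm (J' y s v) \<le> norm (matrix (J' y s)) * norm v"
      using norm_matrix_vector_mult_le[of "matrix (J' y s)" v] by (simp add: fun_cong[OF matrix_vector_mul(2)[OF lin_J']])
    also have "\<dots> \<le> m y s * norm v" by (intro mult_right_mono) (auto simp: m_def)
    finally show "norm (J' y s v) \<le> m y s * norm v" .
  qed
  have lim_m: "((\<lambda>y. SUP s\<in>{0<..<S}. m y s) \<longlongrightarrow> 0) at_infinity"
    using assms(7) unfolding S_def m_def jacobian_eq_matrix[OF J'] .
  have small: "\<exists>R\<ge>1. \<forall>y s. R \<le> norm y \<longrightarrow> 0 \<le> s \<longrightarrow> s \<le> S \<longrightarrow> m y s \<le> \<epsilon>" if "0 < \<epsilon>" for \<epsilon>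
    by (rule bounded_outside_ball_of_SUP_tendsto_0[OF _ S lim_m that])
      (auto intro!: continuous_on_joint[OF cont_m] continuous_intros)
  obtain K where K: "0 \<le> K" "\<And>y s. \<lbrakk>0 \<le> s; s \<le> S\<rbrakk> \<Longrightarrow> m y s \<le> K"
  proof -
    obtain R where R: "\<And>y s. \<lbrakk>R \<le> norm y; 0 \<le> s; s \<le> S\<rbrakk> \<Longrightarrow> m y s \<le> 1"
      using small[of 1] by auto
    have "bdd_above ((\<lambda>(y, s). m y s) ` (cball 0 R \<times> {0..S}))"
      by (intro bounded_imp_bdd_above compact_imp_bounded compact_continuous_image
          continuous_on_subset[OF cont_m] compact_Times) auto
    then obtain K where K: "\<And>y s. \<lbrakk>norm y \<le> R; 0 \<le> s; s \<le> S\<rbrakk> \<Longrightarrow> m y s \<le> K"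
      by (fastforce simp: bdd_above_def)
    have "m y s \<le> max 1 K" if "0 \<le> s" "s \<le> S" for y s
      using K[of y s] R[of y s] that by (cases "norm y \<le> R") auto
    then show ?thesis by (intro that[of "max 1 K"]) auto
  qed
  define \<rho> where "\<rho> y s = H y s \<bullet> H y s" for y s
  define T where "T y s = 2 * (H y s \<bullet> Ds y s)" for y s
  define G where "G y s = (\<Sum>i\<in>Basis. (2 * (H y s \<bullet> D y s i)) *\<^sub>R i)" for y s
  define b where "b y s = \<beta> *\<^sub>R y - J y s" for y s
  define b' where "b' y s v = \<beta> *\<^sub>R v - J' y s v" for y s v
  have G: "G y s \<bullet> v = 2 * (H y s \<bullet> D y s v)" for y s v
  proof -
    have "2 * (H y s \<bullet> D y s v) = 2 * (H y s \<bullet> D y s (\<Sum>i\<in>Basis. (v \<bullet> i) *\<^sub>R i))"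
      by (simp add: euclidean_representation)
    also have "\<dots> = (\<Sum>i\<in>Basis. (v \<bullet> i) * (2 * (H y s \<bullet> D y s i)))"
      by (simp add: blinfun.sum_right blinfun.scaleR_right inner_sum_right sum_distrib_left mult_ac)
    also have "\<dots> = G y s \<bullet> v"
      by (subst inner_commute) (simp add: G_def inner_sum_right mult_ac)
    finally show ?thesis by simp
  qed
  interpret transport \<rho> T G b b' "3 * \<beta>" S
  proof
    show "((\<lambda>z. \<rho> z s) has_derivative (\<lambda>v. G y s \<bullet> v)) (at y)" for y s
      unfolding \<rho>_def G by (auto intro!: derivative_eq_intros D simp: inner_commute)
    show "((\<lambda>t. \<rho> y t) has_real_derivative T y s) (at s)" for y s
    proof -
      have "((\<lambda>t. H y t \<bullet> H y t) has_vector_derivative (H y s \<bullet> Ds y s + Ds y s \<bullet> H y s)) (at s)"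
        by (rule bounded_bilinear.has_vector_derivative[OF bounded_bilinear_inner Ds Ds])
      then show ?thesis
        by (simp add: has_real_derivative_iff_has_vector_derivative \<rho>_def T_def inner_commute)
    qed
    show "continuous_on UNIV (\<lambda>(y, s). \<rho> y s)" "continuous_on UNIV (\<lambda>(y, s). T y s)"
      "continuous_on UNIV (\<lambda>(y, s). G y s)"
      unfolding \<rho>_def T_def G_def split_beta by (intro continuous_intros cont_intros)+
    show "continuous_on UNIV (\<lambda>(y, s). b y s)" "continuous_on UNIV (\<lambda>(y, s). b' y s v)" for v
      unfolding b_def b'_def split_beta
      by (intro continuous_intros continuous_on_joint[OF cont_J] continuous_on_joint[OF cont_J'])+
    show "((\<lambda>z. b z s) has_derivative b' y s) (at y)" for y s
      unfolding b_def b'_def by (auto intro!: derivative_eq_intros J')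
    show "(\<Sum>i\<in>Basis. b' y s i \<bullet> i) = 3 * \<beta>" for y s
      using div_J[of y s] by (simp add: b'_def inner_diff_left sum_subtractf flip: sum_distrib_left)
    show "\<rho> y S = \<rho> y 0" for y
      using assms(3)[of y 0] by (simp add: \<rho>_def S_def)
  qed (use S in \<open>auto simp: \<rho>_def\<close>)
  have transported: "Ds y s + D y s (b y s) = - (\<alpha> / (\<alpha> + 2)) *\<^sub>R H y s - J' y s (H y s)" for y s
  proof -
    have "advect y (\<lambda>z. H z s) y = D y s y"
      by (simp add: advect_def jacobian_eq_matrix[OF D] fun_cong[OF matrix_vector_mul(2)[OF has_derivative_linear[OF D]]])
    moreover have "curl (\<lambda>z. cross3 (curl (\<lambda>x. H x s) z) (H z s)) y = J' y s (H y s) - D y s (J y s)"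
      using curl_cross3_curl[OF D D2 cont_D2s assms(5)] by (simp add: J'_def assms(6))
    ultimately have "Ds y s + (\<alpha> / (\<alpha> + 2)) *\<^sub>R H y s + \<beta> *\<^sub>R D y s y + (J' y s (H y s) - D y s (J y s)) = 0"
      using assms(4)[of y s] by (simp add: \<beta>_def vector_derivative_at[OF Ds])
    moreover have "D y s (b y s) = \<beta> *\<^sub>R D y s y - D y s (J y s)"
      by (simp add: b_def blinfun.diff_right blinfun.scaleR_right)
    ultimately have "(Ds y s + D y s (b y s)) + ((\<alpha> / (\<alpha> + 2)) *\<^sub>R H y s + J' y s (H y s)) = 0"
      by (simp only: add_diff_eq diff_add_eq add_ac)
    then have "Ds y s + D y s (b y s) = - ((\<alpha> / (\<alpha> + 2)) *\<^sub>R H y s + J' y s (H y s))"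
      by (simp only: eq_neg_iff_add_eq_0)
    then show ?thesis by simp
  qed
  have decay: "- (2 * (\<gamma> + \<kappa>) * \<rho> y s) \<le> T y s + G y s \<bullet> b y s" if "m y s \<le> \<kappa>" for y s \<kappa>
  proof -
    have "H y s \<bullet> J' y s (H y s) \<le> norm (H y s) * norm (J' y s (H y s))" by (rule norm_cauchy_schwarz)
    also have "\<dots> \<le> norm (H y s) * (\<kappa> * norm (H y s))"
      using m(2)[of y s "H y s"] mult_right_mono[OF that, of "norm (H y s)"] by (intro mult_left_mono) auto
    also have "\<dots> = \<kappa> * \<rho> y s" by (simp add: \<rho>_def dot_square_norm power2_eq_square)
    finally have 1: "H y s \<bullet> J' y s (H y s) \<le> \<kappa> * \<rho> y s" .
    have 2: "\<alpha> / (\<alpha> + 2) * \<rho> y s \<le> \<gamma> * \<rho> y s"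
      using \<gamma>(2) \<rho>_nonneg by (rule mult_right_mono)
    have "T y s + G y s \<bullet> b y s = 2 * (H y s \<bullet> (Ds y s + D y s (b y s)))"
      by (simp add: T_def G inner_add_right)
    also have "\<dots> = - 2 * (\<alpha> / (\<alpha> + 2) * \<rho> y s) - 2 * (H y s \<bullet> J' y s (H y s))"
      unfolding transported by (simp add: \<rho>_def inner_diff_right algebra_simps)
    finally show ?thesis using 1 2 by (simp add: algebra_simps)
  qed
  have b_y: "b y s \<bullet> y \<le> \<beta> * (y \<bullet> y) + m y s * norm y" "\<beta> * (y \<bullet> y) - m y s * norm y \<le> b y s \<bullet> y" for y s
  proof -
    have "\<bar>J y s \<bullet> y\<bar> \<le> norm (J y s) * norm y" by (rule Cauchy_Schwarz_ineq2)
    also have "\<dots> \<le> m y s * norm y" using m(1) by (rule mult_right_mono) simp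
    finally show "b y s \<bullet> y \<le> \<beta> * (y \<bullet> y) + m y s * norm y" "\<beta> * (y \<bullet> y) - m y s * norm y \<le> b y s \<bullet> y"
      by (auto simp: b_def inner_diff_left)
  qed
  have growth: "b y s \<bullet> y \<le> (\<beta> + K) * (1 + y \<bullet> y)" if "0 \<le> s" "s \<le> S" for y s
  proof -
    have "2 * norm y \<le> 1 + y \<bullet> y"
      using sum_squares_ge_zero[of "norm y - 1" 0]
      by (simp add: dot_square_norm power2_eq_square algebra_simps)
    then have "norm y \<le> 1 + y \<bullet> y" using norm_ge_zero[of y] by linarith
    then have "m y s * norm y \<le> K * (1 + y \<bullet> y)"
      using K that by (intro mult_mono) auto
    then show ?thesis using b_y(1)[of y s] \<beta> by (simp add: algebra_simps)
  qed
  have endpoints: "\<rho> y s = 0" if "\<And>t. \<lbrakk>0 < t; t < S\<rbrakk> \<Longrightarrow> \<rho> y t = 0" "0 \<le> s" "s \<le> S" for y s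
  proof -
    have "{0<..<S} \<subseteq> {t. \<rho> y t = 0}" using that(1) by auto
    moreover have "closed {t. \<rho> y t = 0}"
      by (intro closed_Collect_eq continuous_on_joint[OF cont_\<rho>] continuous_intros)
    ultimately have "closure {0<..<S} \<subseteq> {t. \<rho> y t = 0}" by (rule closure_minimal)
    then show ?thesis using that(2,3) S by (auto simp: closure_greaterThanLessThan)
  qed
  \<comment> \<open>\<open>H\<close> vanishes outside a ball, by the given exponent \<open>q\<close> and a cutoff that lives outside a ball on
    which \<open>J\<close> and its gradient may be large.\<close>
  obtain R where R: "\<And>y s. \<lbrakk>R < norm y; 0 \<le> s; s \<le> S\<rbrakk> \<Longrightarrow> \<rho> y s = 0"
  proof -
    \<comment> \<open>\<open>\<epsilon> \<le> \<beta>\<close> makes \<open>b\<close> point outward where \<open>\<bar>J\<bar> \<le> \<epsilon>\<close> and \<open>\<bar>y\<bar> \<ge> 1\<close>; the other bound uses up half of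
      the surplus \<open>3 \<beta> - q \<gamma>\<close>.\<close>
    define \<epsilon> where "\<epsilon> = min \<beta> ((3 * \<beta> - q * \<gamma>) / (2 * q))"
    have \<epsilon>: "0 < \<epsilon>" "\<epsilon> \<le> \<beta>" "q * (\<gamma> + \<epsilon>) < 3 * \<beta>"
    proof -
      show "0 < \<epsilon>" "\<epsilon> \<le> \<beta>" using \<beta> q q\<gamma> by (auto simp: \<epsilon>_def)
      have "q * \<epsilon> \<le> q * ((3 * \<beta> - q * \<gamma>) / (2 * q))"
        using q by (intro mult_left_mono) (auto simp: \<epsilon>_def)
      also have "\<dots> = (3 * \<beta> - q * \<gamma>) / 2" using q by simp
      finally show "q * (\<gamma> + \<epsilon>) < 3 * \<beta>" using q\<gamma> by (simp add: algebra_simps)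
    qed
    obtain R where R1: "1 \<le> R" and R: "\<And>y s. \<lbrakk>R \<le> norm y; 0 \<le> s; s \<le> S\<rbrakk> \<Longrightarrow> m y s \<le> \<epsilon>"
      using small[OF \<epsilon>(1)] by blast
    have far: "R \<le> norm y" if "R\<^sup>2 < y \<bullet> y" for y :: "real^3"
      by (rule less_imp_le, rule power2_less_imp_less) (use that in \<open>simp_all add: dot_square_norm\<close>)
    define \<eta> where "\<eta> t = 1 - 1 / (1 + (max 0 (t - R\<^sup>2))\<^sup>2)" for t
    define \<eta>' where "\<eta>' t = 2 * max 0 (t - R\<^sup>2) / (1 + (max 0 (t - R\<^sup>2))\<^sup>2)\<^sup>2" for t
    have pos: "0 < 1 + (max 0 (t - R\<^sup>2))\<^sup>2" for t
      by (intro add_pos_nonneg) auto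
    show ?thesis
    proof (rule that[of R], rule endpoints)
      fix y :: "real^3" and s assume y: "R < norm y" and s: "0 < s" "s < S"
      show "\<rho> y s = 0"
      proof (rule vanishes_where_cutoff_positive[where \<eta> = \<eta> and \<eta>' = \<eta>' and C = "\<beta> + K" and k = "\<gamma> + \<epsilon>" and p = "q / 2"])
        show "(\<eta> has_real_derivative \<eta>' t) (at t)" for t
        proof -
          have "((\<lambda>t. (max 0 (t - R\<^sup>2))\<^sup>2) has_real_derivative 2 * max 0 (t - R\<^sup>2) * 1) (at t)"
            by (rule DERIV_chain2[OF DERIV_max_0_power2]) (auto intro!: derivative_eq_intros)
          moreover have "((\<lambda>t. 1 - 1 / (1 + f t)) has_real_derivative f' / (1 + f t)\<^sup>2) (at t)"
            if "(f has_real_derivative f') (at t)" "0 < 1 + f t" for f f'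
            using that by (auto intro!: derivative_eq_intros simp: power2_eq_square)
          ultimately have "((\<lambda>t. 1 - 1 / (1 + (max 0 (t - R\<^sup>2))\<^sup>2)) has_real_derivative
              2 * max 0 (t - R\<^sup>2) * 1 / (1 + (max 0 (t - R\<^sup>2))\<^sup>2)\<^sup>2) (at t)"
            using pos by blast
          then show ?thesis by (simp add: \<eta>_def[abs_def] \<eta>'_def)
        qed
        show "continuous_on UNIV \<eta>'"
          unfolding \<eta>'_def using pos by (intro continuous_intros) (auto simp: less_imp_neq[symmetric])
        show "0 \<le> \<eta> t" "\<eta> t \<le> 1" for t
          using pos[of t] by (auto simp: \<eta>_def field_simps)
        show "0 \<le> \<eta>' (y \<bullet> y) * (b y s \<bullet> y)" if s: "0 \<le> s" "s \<le> S" for y s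
        proof (cases "R\<^sup>2 < y \<bullet> y")
          case True
          then have y: "R \<le> norm y" by (rule far)
          have "m y s * norm y \<le> \<beta> * norm y * norm y"
          proof (rule mult_right_mono)
            have "\<beta> * 1 \<le> \<beta> * norm y" using \<beta> R1 y by (intro mult_left_mono) auto
            then show "m y s \<le> \<beta> * norm y" using R[OF y s] \<epsilon>(2) by linarith
          qed simp
          then have "0 \<le> b y s \<bullet> y"
            using b_y(2)[of y s] by (simp add: dot_square_norm power2_eq_square)
          moreover have "0 \<le> \<eta>' (y \<bullet> y)" by (simp add: \<eta>'_def)
          ultimately show ?thesis by simp
        qed (simp add: \<eta>'_def)
        show "- (2 * (\<gamma> + \<epsilon>) * \<rho> y s) \<le> T y s + G y s \<bullet> b y s"
          if "0 \<le> s" "s \<le> S" "\<eta> (y \<bullet> y) \<noteq> 0" for y s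
        proof -
          have "max 0 (y \<bullet> y - R\<^sup>2) \<noteq> 0" using that(3) by (auto simp: \<eta>_def)
          then have "R\<^sup>2 < y \<bullet> y" by (simp add: max_def split: if_splits)
          then show ?thesis by (intro decay R far that)
        qed
        show "integrable lborel (\<lambda>(y, s). indicator {0..S} s * \<rho> y s powr (q / 2))"
          unfolding \<rho>_def by (rule in_Lq_imp_integrable[OF cont_H q])
        have "R\<^sup>2 < y \<bullet> y" using y R1 by (simp add: dot_square_norm power_strict_mono)
        then have "0 < (max 0 (y \<bullet> y - R\<^sup>2))\<^sup>2" by simp
        then show "0 < \<eta> (y \<bullet> y)" using pos[of "y \<bullet> y"] by (simp add: \<eta>_def field_simps)
      qed (use \<beta> \<gamma> K \<epsilon> q s growth in auto)
    qed
  qed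
  \<comment> \<open>With compact support every exponent is integrable, so the bound \<open>K\<close> on the gradient of \<open>J\<close> can be
    beaten by a small exponent \<open>p\<close>, with \<open>\<eta> = 1\<close> on the whole space.\<close>
  have zero: "\<rho> y s = 0" if s: "0 < s" "s < S" for y s
  proof -
    define p where "p = 3 * \<beta> / (2 * (\<gamma> + K + 1))"
    have p: "0 < p" using \<beta> \<gamma> K by (simp add: p_def)
    have "2 * p * (\<gamma> + K) < 2 * p * (\<gamma> + K + 1)" using p by simp
    also have "\<dots> = 3 * \<beta>" using \<gamma> K by (simp add: p_def field_simps)
    finally have expand: "2 * p * (\<gamma> + K) < 3 * \<beta>" .
    have integrable: "integrable lborel (\<lambda>(y, s). indicator {0..S} s * \<rho> y s powr p)"
    proof -
      have "integrable lborel (\<lambda>x. indicator (cball 0 R \<times> {0..S}) x *\<^sub>R (\<rho> (fst x) (snd x) powr p))"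
        using p \<rho>_nonneg
        by (intro borel_integrable_compact compact_Times compact_cball compact_Icc continuous_on_powr'
            continuous_on_joint[OF cont_\<rho>] continuous_intros) auto
      moreover have "indicator (cball 0 R \<times> {0..S}) x *\<^sub>R (\<rho> (fst x) (snd x) powr p)
          = (\<lambda>(y, s). indicator {0..S} s * \<rho> y s powr p) x" for x
        using R[of "fst x" "snd x"] by (cases x) (auto simp: indicator_def not_le)
      ultimately show ?thesis by simp
    qed
    show ?thesis
      by (rule vanishes_where_cutoff_positive[where \<eta> = "\<lambda>_. 1" and \<eta>' = "\<lambda>_. 0" and C = "\<beta> + K" and k = "\<gamma> + K" and p = p])
        (use \<beta> \<gamma> K p expand integrable s growth decay in auto)
  qed
  have period: "H y (s + real n * S) = H y s" for y s n
  proof (induction n)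
    case (Suc n)
    then show ?case using assms(3)[of y "s + real n * S"] by (simp add: S_def algebra_simps)
  qed simp
  show ?thesis
  proof (intro allI)
    fix y s
    define n where "n = \<lfloor>s / S\<rfloor>"
    define t where "t = s - of_int n * S"
    have t: "0 \<le> t" "t \<le> S"
      using S floor_divide_lower[OF S, of s] floor_divide_upper[OF S, of s]
      by (auto simp: t_def n_def algebra_simps)
    have "H y t = 0" using endpoints[OF zero t] by (simp add: \<rho>_def)
    moreover have "H y s = H y t"
    proof (cases "0 \<le> n")
      case True
      then show ?thesis using period[of y t "nat n"] by (simp add: t_def)
    next
      case False
      then show ?thesis using period[of y s "nat (- n)"] by (simp add: t_def)
    qed
    ultimately show "H y s = 0" by simp
  qed
qed

end
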